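(* Let $m \ge 58$ be an odd integer, and let $G$ be a graph with exactly $m$ edges and no isolated vertices that contains no subgraph isomorphic to $H(4,3)$, and such that $G$ is not isomorphic to $K_2 \vee \frac{m-1}{2}K_1$. Then \[ \lambda(G) \le \tilde{\lambda}(m), \] where $\tilde{\lambda}(m)$ is the largest root of $x^4 - m x^2 - (m-3)x + m - 3 = 0$. Moreover, equality holds if and only if $G \cong K_1 \vee \left( K_{1,\frac{m-3}{2}} \cup 2K_1 \right)$.
   Context: All graphs are simple. $\lambda(G)$ denotes the spectral radius (largest eigenvalue) of the adjacency matrix of $G$. The fish graph $H(4,3)$ is the 6-vertex graph obtained from a cycle of length 4 and a triangle by identifying one vertex of the cycle with one vertex of the triangle. A graph contains $H$ if it has a (not necessarily induced) subgraph isomorphic to $H$. For graphs $A$ and $B$, $A \vee B$ denotes their join (disjoint union plus all edges between $V(A)$ and $V(B)$), $A \cup B$ denotes their disjoint union, $kA$ denotes the disjoint union of $k$ copies of $A$, $K_n$ is the complete graph on $n$ vertices, and $K_{1,r}$ is the star with $r$ edges. Thus $K_2 \vee \frac{m-1}{2}K_1$ is the book graph with $m$ edges (two adjacent vertices both joined to $\frac{m-1}{2}$ further independent vertices). *)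

theory Defs
  imports
    "Graph_Theory.Graph_Theory"
    "Jordan_Normal_Form.Spectral_Radius"
begin

text \<open>
  A finite simple graph is a \<open>pair_graph\<close>: a finite vertex set \<open>pverts G\<close> together with a
  symmetric irreflexive relation \<open>parcs G\<close> on it, so an undirected edge appears as two arcs.
\<close>

definition edge_set :: "'a pair_pre_digraph \<Rightarrow> 'a set set" where
  "edge_set G = (\<lambda>(u, v). {u, v}) ` parcs G"

definition isolated_vertex :: "'a pair_pre_digraph \<Rightarrow> 'a \<Rightarrow> bool" where
  "isolated_vertex G v \<longleftrightarrow> v \<in> pverts G \<and> (\<forall>w. (v, w) \<notin> parcs G)"

text \<open>
  Between symmetric arc relations, \<open>digraph_iso\<close> amounts to a bijection of the vertices that
  preserves and reflects adjacency, i.e. isomorphism of undirected graphs.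
\<close>

abbreviation graph_iso :: "'a pair_pre_digraph \<Rightarrow> 'b pair_pre_digraph \<Rightarrow> bool"
  (infix \<open>\<cong>\<^sub>g\<close> 50) where
  "G \<cong>\<^sub>g H \<equiv> digraph_iso (with_proj G) (with_proj H)"

definition contains_graph :: "'a pair_pre_digraph \<Rightarrow> 'b pair_pre_digraph \<Rightarrow> bool" where
  "contains_graph G H \<longleftrightarrow> (\<exists>K. subgraph (with_proj K) (with_proj G) \<and> H \<cong>\<^sub>g K)"


subsection \<open>Constructions of graphs\<close>

definition complete_graph :: "nat \<Rightarrow> nat pair_pre_digraph" where
  "complete_graph n = \<lparr> pverts = {..<n}, parcs = {(i, j). i < n \<and> j < n \<and> i \<noteq> j} \<rparr>"

text \<open>The star \<open>K\<^bsub>1,r\<^esub>\<close>, with centre \<open>0\<close> and leaves \<open>1, \<dots>, r\<close>.\<close>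

definition star_graph :: "nat \<Rightarrow> nat pair_pre_digraph" where
  "star_graph r = \<lparr> pverts = {0..r}, parcs = {0} \<times> {1..r} \<union> {1..r} \<times> {0} \<rparr>"

definition disjoint_union ::
  "'a pair_pre_digraph \<Rightarrow> 'b pair_pre_digraph \<Rightarrow> ('a + 'b) pair_pre_digraph" where
  "disjoint_union A B =
    \<lparr> pverts = pverts A <+> pverts B,
      parcs = map_prod Inl Inl ` parcs A \<union> map_prod Inr Inr ` parcs B \<rparr>"

definition graph_join ::
  "'a pair_pre_digraph \<Rightarrow> 'b pair_pre_digraph \<Rightarrow> ('a + 'b) pair_pre_digraph" where
  "graph_join A B =
    \<lparr> pverts = pverts A <+> pverts B,
      parcs = parcs (disjoint_union A B)
        \<union> (Inl ` pverts A) \<times> (Inr ` pverts B) \<union> (Inr ` pverts B) \<times> (Inl ` pverts A) \<rparr>"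

definition copies :: "nat \<Rightarrow> 'a pair_pre_digraph \<Rightarrow> (nat \<times> 'a) pair_pre_digraph" where
  "copies k A =
    \<lparr> pverts = {..<k} \<times> pverts A,
      parcs = {((i, u), (j, v)). i < k \<and> j = i \<and> (u, v) \<in> parcs A} \<rparr>"

text \<open>
  The fish graph \<open>H(4,3)\<close>: the 4-cycle \<open>0, 1, 2, 3\<close> and the triangle \<open>0, 4, 5\<close> share the
  vertex \<open>0\<close>.
\<close>

definition fish_graph :: "nat pair_pre_digraph" where
  "fish_graph =
    (let E = {(0, 1), (1, 2), (2, 3), (3, 0), (0, 4), (4, 5), (5, 0)}
     in \<lparr> pverts = {0, 1, 2, 3, 4, 5}, parcs = E \<union> E\<inverse> \<rparr>)"


subsection \<open>Spectral radius of a graph\<close>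

text \<open>
  The adjacency matrix with respect to an arbitrary enumeration of the vertices; the choice
  only conjugates the matrix by a permutation, so eigenvalues do not depend on it.
\<close>

definition vertex_enum :: "'a pair_pre_digraph \<Rightarrow> 'a list" where
  "vertex_enum G = (SOME vs. distinct vs \<and> set vs = pverts G)"

definition adjacency_matrix :: "'a pair_pre_digraph \<Rightarrow> complex mat" where
  "adjacency_matrix G =
    (let vs = vertex_enum G; n = length vs
     in mat n n (\<lambda>(i, j). if (vs ! i, vs ! j) \<in> parcs G then 1 else 0))"

text \<open>
  \<open>spectral_radius\<close> is the maximum modulus of the complex eigenvalues; for the symmetric
  nonnegative matrix here this is the largest (real) eigenvalue, by Perron--Frobenius.
\<close>

definition graph_spectral_radius :: "'a pair_pre_digraph \<Rightarrow> real" where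
  "graph_spectral_radius G = spectral_radius (adjacency_matrix G)"

definition lambda_tilde :: "nat \<Rightarrow> real" where
  "lambda_tilde m = Max {x. x ^ 4 - real m * x ^ 2 - (real m - 3) * x + real m - 3 = 0}"

end

theory Submission
  imports Defs "HOL-Analysis.Function_Topology"
begin

text \<open>
  Let \<open>\<lambda>\<close> be the spectral radius of \<open>G\<close> and \<open>x\<close> a nonnegative eigenvector for \<open>\<lambda>\<close>, scaled so
  that its maximum is \<open>x u = 1\<close>. Put \<open>N = N(u)\<close>, let \<open>W\<close> be the set of vertices outside
  \<open>N \<union> {u}\<close>, and let \<open>d\<^sub>N\<close> and \<open>d\<^sub>W\<close> count neighbours in \<open>N\<close> and \<open>W\<close>. Expanding \<open>\<lambda>\<^sup>2 x u\<close> and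
  counting edges gives that \<open>\<lambda>\<^sup>2 - \<lambda>\<close> equals
  \<open>m + (\<Sum>v\<in>N. (d\<^sub>N v - 1) x v - d\<^sub>N v / 2) - (\<Sum>w\<in>W. d\<^sub>N w (1 - x w)) - (\<Sum>w\<in>W. d\<^sub>W w) / 2\<close>.
  If \<open>\<lambda>\<close> is at least the largest root of the quartic, then \<open>\<lambda> > 8\<close> and \<open>\<lambda>\<^sup>2 - \<lambda> > m - 2\<close>. As the
  values of \<open>x\<close> on \<open>N\<close> add up to \<open>\<lambda>\<close>, the subgraph induced on \<open>N\<close> has more than six edges and is
  not a matching. It contains no \<open>P\<^sub>3 \<union> K\<^sub>2\<close>, since this would form a fish together with \<open>u\<close>; so
  its edges form a star. The bound \<open>\<lambda>\<^sup>2 - \<lambda> > m - 2\<close> then leaves no room for \<open>W\<close>, nor for more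
  than two isolated vertices in the subgraph on \<open>N\<close>.
\<close>

subsection \<open>The spectral radius of a graph\<close>

text \<open>The unit sphere in the coordinates of \<open>V\<close> is compact and the form is
  continuous on it; homogeneity carries the maximum over to all vectors.\<close>

lemma quadratic_form_attains_max:
  fixes a :: "'a \<Rightarrow> 'a \<Rightarrow> real"
  assumes fin: "finite V" and ne: "V \<noteq> {}"
  obtains x where "(\<Sum>v\<in>V. (x v)\<^sup>2) = 1"
    and "\<And>y. (\<Sum>v\<in>V. y v * (\<Sum>w\<in>V. a v w * y w))
      \<le> (\<Sum>v\<in>V. x v * (\<Sum>w\<in>V. a v w * x w)) * (\<Sum>v\<in>V. (y v)\<^sup>2)"
proof -
  define Q where "Q y = (\<Sum>v\<in>V. y v * (\<Sum>w\<in>V. a v w * y w))" for y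
  define N where "N y = (\<Sum>v\<in>V. (y v)\<^sup>2)" for y :: "'a \<Rightarrow> real"
  \<comment> \<open>Vectors are functions on the whole type, so coordinates outside \<open>V\<close>
    are pinned to 0; the cube is then a product of compact sets, compact by Tychonoff.\<close>
  define B where "B = (\<Pi>\<^sub>E v\<in>UNIV. if v \<in> V then {-1..1} else {0::real})"
  have contQ: "continuous_on UNIV Q" and contN: "continuous_on UNIV N"
    unfolding Q_def N_def by (intro continuous_intros continuous_on_product_coordinates)+
  have "compactin (product_topology (\<lambda>_. euclidean) UNIV) B"
    unfolding B_def by (subst compactin_PiE) auto
  then have "compact B"
    by (simp add: euclidean_product_topology)
  moreover have "closed {x. N x = 1}"
    by (rule closed_Collect_eq) (use contN in auto)
  ultimately have compact: "compact (B \<inter> {x. N x = 1})"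
    by (rule compact_Int_closed)
  \<comment> \<open>\<open>Q\<close> and \<open>N\<close> see only the coordinates in
    \<open>V\<close>, so cutting a vector off outside \<open>V\<close> brings it into the cube
    without changing either.\<close>
  have unit_mem: "(\<lambda>v. if v \<in> V then y v else 0) \<in> B \<inter> {x. N x = 1}" if "N y = 1" for y
  proof -
    have "\<bar>y v\<bar> \<le> 1" if "v \<in> V" for v
    proof -
      have "(y v)\<^sup>2 \<le> N y"
        unfolding N_def using fin that by (intro member_le_sum) auto
      then show ?thesis using \<open>N y = 1\<close> by (simp add: abs_square_le_1)
    qed
    then have "(\<lambda>v. if v \<in> V then y v else 0) \<in> B"
      unfolding B_def by (auto simp: abs_le_iff)
    moreover have "N (\<lambda>v. if v \<in> V then y v else 0) = N y"
      unfolding N_def by simp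
    ultimately show ?thesis using that by simp
  qed
  obtain v0 where v0: "v0 \<in> V" using ne by blast
  have "N (\<lambda>v. if v = v0 then 1 else 0) = 1"
    unfolding N_def using fin v0 by (simp add: if_distrib[of "\<lambda>z. z\<^sup>2"] sum.delta cong: if_cong)
  from unit_mem[OF this] have "B \<inter> {x. N x = 1} \<noteq> {}" by blast
  with compact obtain x where x: "x \<in> B \<inter> {x. N x = 1}"
    and max: "\<forall>y\<in>B \<inter> {x. N x = 1}. Q y \<le> Q x"
    using continuous_attains_sup continuous_on_subset[OF contQ] by (metis subset_UNIV)
  have "Q y \<le> Q x * N y" for y
  proof (cases "N y = 0")
    case True
    then have "\<forall>v\<in>V. y v = 0"
      unfolding N_def using fin by (simp add: sum_nonneg_eq_0_iff)
    then have "Q y = 0" unfolding Q_def by simp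
    then show ?thesis using True by simp
  next
    case False
    then have pos: "N y > 0"
      unfolding N_def by (simp add: less_le sum_nonneg)
    define z where "z v = y v / sqrt (N y)" for v
    have "N z = N y / N y"
      unfolding N_def z_def power_divide sum_divide_distrib[symmetric]
      by (subst real_sqrt_pow2) (auto simp: sum_nonneg)
    then have "N z = 1" using False by simp
    have "Q (\<lambda>v. if v \<in> V then z v else 0) = Q z"
      unfolding Q_def by simp
    then have "Q z \<le> Q x"
      using max unit_mem[OF \<open>N z = 1\<close>] by metis
    moreover have "Q z = Q y / (sqrt (N y) * sqrt (N y))"
      unfolding Q_def z_def by (simp add: sum_divide_distrib sum_distrib_left)
    then have "Q z = Q y / N y" using pos by simp
    ultimately show ?thesis using pos by (simp add: field_simps)
  qed
  with x show ?thesis using that[of x] unfolding Q_def N_def by blast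
qed

text \<open>First variation: a step \<open>t * h\<close> along the residual \<open>h\<close> of the
  eigenvalue equation changes form minus \<open>M\<close> times squared norm by
  \<open>2 * t * S\<close> plus a term in \<open>t^2\<close>, where \<open>S\<close> is the squared
  norm of \<open>h\<close>. This stays nonpositive for all \<open>t\<close> only if
  \<open>S = 0\<close>.\<close>

lemma symmetric_form_maximizer_is_eigenvector:
  fixes a :: "'a \<Rightarrow> 'a \<Rightarrow> real"
  assumes fin: "finite V" and sym: "\<And>v w. a v w = a w v"
    and bound: "\<And>y. (\<Sum>v\<in>V. y v * (\<Sum>w\<in>V. a v w * y w)) \<le> M * (\<Sum>v\<in>V. (y v)\<^sup>2)"
    and attained: "M * (\<Sum>v\<in>V. (x v)\<^sup>2) \<le> (\<Sum>v\<in>V. x v * (\<Sum>w\<in>V. a v w * x w))"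
    and v: "v \<in> V"
  shows "(\<Sum>w\<in>V. a v w * x w) = M * x v"
proof -
  define A where "A y v = (\<Sum>w\<in>V. a v w * y w)" for y :: "'a \<Rightarrow> real" and v
  define ip where "ip y z = (\<Sum>v\<in>V. y v * z v)" for y z :: "'a \<Rightarrow> real"
  define h where "h v = A x v - M * x v" for v
  define S where "S = (\<Sum>v\<in>V. (h v)\<^sup>2)"
  have sa: "ip x (A h) = ip h (A x)"
  proof -
    have "ip x (A h) = (\<Sum>v\<in>V. \<Sum>w\<in>V. x v * a v w * h w)"
      unfolding ip_def A_def by (simp add: sum_distrib_left mult.assoc)
    also have "\<dots> = (\<Sum>w\<in>V. \<Sum>v\<in>V. x v * a v w * h w)"
      by (rule sum.swap)
    also have "\<dots> = ip h (A x)"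
      unfolding ip_def A_def using sym by (simp add: sum_distrib_left mult_ac)
    finally show ?thesis .
  qed
  have S: "ip h (A x) - M * ip x h = S"
    unfolding ip_def S_def h_def sum_distrib_left sum_subtractf[symmetric]
    by (rule sum.cong) (auto simp: power2_eq_square algebra_simps)
  have *: "2 * t * S + t\<^sup>2 * (ip h (A h) - M * ip h h) \<le> 0" for t
  proof -
    define y where "y v = x v + t * h v" for v
    have Ay: "A y v = A x v + t * A h v" for v
      unfolding A_def y_def by (simp add: algebra_simps sum.distrib sum_distrib_left)
    have "ip y (A y) = ip x (A x) + t * ip h (A x) + t * ip x (A h) + t\<^sup>2 * ip h (A h)"
      unfolding ip_def Ay sum_distrib_left sum.distrib[symmetric]
      by (rule sum.cong) (auto simp: y_def algebra_simps power2_eq_square)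
    moreover have "ip y y = ip x x + 2 * t * ip x h + t\<^sup>2 * ip h h"
      unfolding ip_def sum_distrib_left sum.distrib[symmetric]
      by (rule sum.cong) (auto simp: y_def algebra_simps power2_eq_square)
    moreover have "ip y (A y) \<le> M * ip y y"
      using bound[of y] unfolding ip_def A_def by (simp add: power2_eq_square)
    moreover have "M * ip x x \<le> ip x (A x)"
      using attained unfolding ip_def A_def by (simp add: power2_eq_square)
    ultimately show ?thesis using sa S by (simp add: algebra_simps)
  qed
  have "S \<le> 0"
  proof (rule ccontr)
    assume "\<not> S \<le> 0"
    \<comment> \<open>\<open>C\<close> dominates the quadratic coefficient and the summand
      \<open>S\<close> keeps it positive; the choice \<open>t = S / C\<close> then leaves at least
      \<open>S * S / C > 0\<close>.\<close>
    define C where "C = \<bar>ip h (A h) - M * ip h h\<bar> + S"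
    have C: "C > 0" "C \<ge> S" using \<open>\<not> S \<le> 0\<close> by (auto simp: C_def)
    have "2 * (S / C) * S - (S / C)\<^sup>2 * C \<le> 2 * (S / C) * S + (S / C)\<^sup>2 * (ip h (A h) - M * ip h h)"
    proof -
      have "- C \<le> ip h (A h) - M * ip h h" using \<open>\<not> S \<le> 0\<close> by (auto simp: C_def)
      from mult_left_mono[OF this, of "(S / C)\<^sup>2"] show ?thesis by simp
    qed
    also have "\<dots> \<le> 0" by (rule *)
    finally have "S * S / C \<le> 0" using C by (simp add: power2_eq_square field_simps)
    moreover have "S * S / C > 0" using C \<open>\<not> S \<le> 0\<close> by simp
    ultimately show False by simp
  qed
  then have "S = 0" unfolding S_def by (simp add: order_antisym sum_nonneg)
  then have "h v = 0"
    unfolding S_def using fin v by (simp add: sum_nonneg_eq_0_iff)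
  then show ?thesis unfolding h_def A_def by simp
qed

text \<open>With nonnegative coefficients, passing to absolute values cannot lower the form, so the
  absolute value of a maximizer is again a maximizer and hence an eigenvector.\<close>

lemma nonneg_symmetric_form_nonneg_maximizer:
  fixes a :: "'a \<Rightarrow> 'a \<Rightarrow> real"
  assumes fin: "finite V" and ne: "V \<noteq> {}"
    and sym: "\<And>v w. a v w = a w v" and nonneg: "\<And>v w. a v w \<ge> 0"
  obtains M x where "\<And>v. v \<in> V \<Longrightarrow> x v \<ge> 0" and "\<exists>v\<in>V. x v > 0"
    and "\<And>v. v \<in> V \<Longrightarrow> (\<Sum>w\<in>V. a v w * x w) = M * x v"
    and "\<And>y. (\<Sum>v\<in>V. y v * (\<Sum>w\<in>V. a v w * y w)) \<le> M * (\<Sum>v\<in>V. (y v)\<^sup>2)"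
proof -
  obtain x where x: "(\<Sum>v\<in>V. (x v)\<^sup>2) = 1"
    and max: "\<And>y. (\<Sum>v\<in>V. y v * (\<Sum>w\<in>V. a v w * y w))
      \<le> (\<Sum>v\<in>V. x v * (\<Sum>w\<in>V. a v w * x w)) * (\<Sum>v\<in>V. (y v)\<^sup>2)"
    using quadratic_form_attains_max[OF fin ne] by blast
  define M where "M = (\<Sum>v\<in>V. x v * (\<Sum>w\<in>V. a v w * x w))"
  have "M \<le> (\<Sum>v\<in>V. \<bar>x v\<bar> * (\<Sum>w\<in>V. a v w * \<bar>x w\<bar>))"
    unfolding M_def sum_distrib_left
  proof (intro sum_mono)
    fix v w
    have "x v * (a v w * x w) \<le> \<bar>x v * (a v w * x w)\<bar>" by simp
    also have "\<dots> = \<bar>x v\<bar> * (a v w * \<bar>x w\<bar>)" using nonneg by (simp add: abs_mult)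
    finally show "x v * (a v w * x w) \<le> \<bar>x v\<bar> * (a v w * \<bar>x w\<bar>)" .
  qed
  then have attained: "M * (\<Sum>v\<in>V. \<bar>x v\<bar>\<^sup>2) \<le> (\<Sum>v\<in>V. \<bar>x v\<bar> * (\<Sum>w\<in>V. a v w * \<bar>x w\<bar>))"
    using x by simp
  have "\<exists>v\<in>V. \<bar>x v\<bar> > 0"
  proof (rule ccontr)
    assume "\<not> ?thesis"
    then have "(\<Sum>v\<in>V. (x v)\<^sup>2) = 0" by simp
    then show False using x by simp
  qed
  moreover have "(\<Sum>w\<in>V. a v w * \<bar>x w\<bar>) = M * \<bar>x v\<bar>" if "v \<in> V" for v
    using symmetric_form_maximizer_is_eigenvector[OF fin sym max[folded M_def] attained that] .
  ultimately show ?thesis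
    using that[of "\<lambda>v. \<bar>x v\<bar>" M] max unfolding M_def by simp
qed

section \<open>Neighbourhoods and the spectrum of the adjacency matrix\<close>

definition nbrs :: "'a pair_pre_digraph \<Rightarrow> 'a \<Rightarrow> 'a set" where
  "nbrs G v = {w. (v, w) \<in> parcs G}"

lemma nbrs_subset_verts: "pair_graph G \<Longrightarrow> nbrs G v \<subseteq> pverts G"
  unfolding nbrs_def using pair_wf_digraph.in_arcsD2
  by (metis mem_Collect_eq pair_digraph.axioms(1) pair_fin_digraph.axioms(1) pair_graph_def subsetI)

lemma finite_pverts: "pair_graph G \<Longrightarrow> finite (pverts G)"
  by (meson pair_digraph.axioms(1) pair_fin_digraph.pair_finite_verts pair_graph_def)

lemma finite_nbrs: "pair_graph G \<Longrightarrow> finite (nbrs G v)"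
  by (meson finite_pverts finite_subset nbrs_subset_verts)

lemma nbrs_sym:
  assumes "pair_graph G"
  shows "w \<in> nbrs G v \<longleftrightarrow> v \<in> nbrs G w"
proof -
  interpret pair_graph G by fact
  show ?thesis unfolding nbrs_def using arcs_symmetric by blast
qed

lemma nbrs_irrefl:
  assumes "pair_graph G"
  shows "v \<notin> nbrs G v"
proof -
  interpret pair_graph G by fact
  show ?thesis unfolding nbrs_def using pair_no_loops by force
qed

lemma vertex_enum:
  assumes "pair_graph G"
  shows "distinct (vertex_enum G)" and "set (vertex_enum G) = pverts G"
proof -
  obtain vs where "distinct vs \<and> set vs = pverts G"
    using finite_distinct_list[OF finite_pverts[OF assms]] by blast
  then have "distinct (vertex_enum G) \<and> set (vertex_enum G) = pverts G"
    unfolding vertex_enum_def by (rule someI)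
  then show "distinct (vertex_enum G)" "set (vertex_enum G) = pverts G" by auto
qed

lemma sum_nbrs_eq:
  fixes f :: "'a \<Rightarrow> 'b::semiring_1"
  assumes "pair_graph G"
  shows "(\<Sum>w\<in>pverts G. of_bool (w \<in> nbrs G v) * f w) = (\<Sum>w\<in>nbrs G v. f w)"
proof -
  have "(\<Sum>w\<in>nbrs G v. f w) = (\<Sum>w\<in>nbrs G v. of_bool (w \<in> nbrs G v) * f w)"
    by (rule sum.cong) auto
  also have "\<dots> = (\<Sum>w\<in>pverts G. of_bool (w \<in> nbrs G v) * f w)"
    by (rule sum.mono_neutral_left)
      (use finite_pverts[OF assms] nbrs_subset_verts[OF assms] in auto)
  finally show ?thesis by simp
qed

lemma adjacency_matrix_mult_vec:
  fixes f :: "'a \<Rightarrow> complex"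
  assumes G: "pair_graph G" and i: "i < length (vertex_enum G)"
  shows "(adjacency_matrix G *\<^sub>v vec (length (vertex_enum G)) (\<lambda>i. f (vertex_enum G ! i))) $ i
    = (\<Sum>w\<in>nbrs G (vertex_enum G ! i). f w)"
proof -
  define vs where "vs = vertex_enum G"
  have bij: "bij_betw ((!) vs) {..<length vs} (pverts G)"
    using bij_betw_nth[of vs "{..<length vs}"] vertex_enum[OF G] by (simp add: vs_def)
  have "(adjacency_matrix G *\<^sub>v vec (length vs) (\<lambda>i. f (vs ! i))) $ i
    = (\<Sum>j = 0..<length vs. (if (vs ! i, vs ! j) \<in> parcs G then 1 else 0) * f (vs ! j))"
    using i unfolding adjacency_matrix_def vs_def[symmetric] Let_def
    by (simp add: scalar_prod_def)
  also have "\<dots> = (\<Sum>j\<in>{..<length vs}. of_bool (vs ! j \<in> nbrs G (vs ! i)) * f (vs ! j))"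
    by (simp only: of_bool_def nbrs_def lessThan_atLeast0 mem_Collect_eq)
  also have "\<dots> = (\<Sum>w\<in>pverts G. of_bool (w \<in> nbrs G (vs ! i)) * f w)"
    by (rule sum.reindex_bij_betw[OF bij])
  finally show ?thesis using sum_nbrs_eq[OF G] by (simp add: vs_def)
qed

text \<open>Vectors indexed by the enumeration correspond to functions on the vertices, so
  eigenvalues can be handled without the arbitrary \<open>vertex_enum\<close>.\<close>

lemma spectrum_adjacency_matrix:
  assumes G: "pair_graph G"
  shows "\<mu> \<in> spectrum (adjacency_matrix G) \<longleftrightarrow>
    (\<exists>f. (\<exists>v\<in>pverts G. f v \<noteq> 0) \<and> (\<forall>v\<in>pverts G. (\<Sum>w\<in>nbrs G v. f w) = \<mu> * f v))"
    (is "?L \<longleftrightarrow> ?R")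
proof -
  define vs where "vs = vertex_enum G"
  define n where "n = length vs"
  note vs = vertex_enum[OF G, folded vs_def]
  have dim: "dim_row (adjacency_matrix G) = n"
    unfolding adjacency_matrix_def vs_def n_def Let_def by simp
  note mult = adjacency_matrix_mult_vec[OF G, folded vs_def, folded n_def]
  have ev: "eigenvector (adjacency_matrix G) (vec n (\<lambda>i. f (vs ! i))) \<mu> \<longleftrightarrow>
    (\<exists>v\<in>pverts G. f v \<noteq> 0) \<and> (\<forall>v\<in>pverts G. (\<Sum>w\<in>nbrs G v. f w) = \<mu> * f v)" for f
  proof -
    have "vec n (\<lambda>i. f (vs ! i)) \<noteq> 0\<^sub>v n \<longleftrightarrow> (\<exists>i<n. f (vs ! i) \<noteq> 0)"
      by (auto simp: vec_eq_iff)
    moreover have "adjacency_matrix G *\<^sub>v vec n (\<lambda>i. f (vs ! i)) = \<mu> \<cdot>\<^sub>v vec n (\<lambda>i. f (vs ! i)) \<longleftrightarrow>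
      (\<forall>i<n. (\<Sum>w\<in>nbrs G (vs ! i). f w) = \<mu> * f (vs ! i))"
      using mult dim by (auto simp: vec_eq_iff)
    ultimately show ?thesis
      unfolding eigenvector_def dim vs(2)[symmetric] n_def by (auto simp: set_conv_nth)
  qed
  show ?thesis
  proof
    assume ?L
    then obtain u where u: "eigenvector (adjacency_matrix G) u \<mu>"
      unfolding spectrum_def eigenvalue_def by blast
    then have "dim_vec u = n" unfolding eigenvector_def dim by auto
    \<comment> \<open>A vector yields a function by inverting the enumeration, which is injective
      because it lists no vertex twice.\<close>
    moreover have "\<exists>f. \<forall>i<n. f (vs ! i) = u $ i"
      using bij_betw_nth[OF vs(1) refl refl]
      by (intro exI[of _ "\<lambda>v. u $ (the_inv_into {..<length vs} ((!) vs) v)"])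
        (auto simp: n_def bij_betw_def the_inv_into_f_f)
    then obtain f where "\<forall>i<n. f (vs ! i) = u $ i" by blast
    ultimately have "u = vec n (\<lambda>i. f (vs ! i))" by auto
    then show ?R using u ev by blast
  next
    assume ?R
    then show ?L unfolding spectrum_def eigenvalue_def using ev by blast
  qed
qed

lemma graph_spectral_radius:
  assumes G: "pair_graph G" and ne: "pverts G \<noteq> {}"
  shows "graph_spectral_radius G \<in> norm ` spectrum (adjacency_matrix G)"
    and "\<mu> \<in> spectrum (adjacency_matrix G) \<Longrightarrow> norm \<mu> \<le> graph_spectral_radius G"
proof -
  define n where "n = length (vertex_enum G)"
  have A: "adjacency_matrix G \<in> carrier_mat n n"
    unfolding adjacency_matrix_def n_def Let_def by simp
  have "n > 0" using ne vertex_enum(2)[OF G] by (auto simp: n_def)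
  from spectral_radius_mem_max[OF A this]
  show "graph_spectral_radius G \<in> norm ` spectrum (adjacency_matrix G)"
    and "\<mu> \<in> spectrum (adjacency_matrix G) \<Longrightarrow> norm \<mu> \<le> graph_spectral_radius G"
    unfolding graph_spectral_radius_def by auto
qed

text \<open>The maximum \<open>M\<close> of the form is an eigenvalue, hence at most the spectral
  radius. Conversely, for an eigenvalue of maximal modulus, the entrywise modulus of an eigenvector
  shows by the triangle inequality that \<open>M\<close> is at least that modulus. So the
  nonnegative maximizer belongs to the spectral radius.\<close>

lemma ex_nonneg_eigenvector:
  assumes G: "pair_graph G" and ne: "pverts G \<noteq> {}"
  obtains x :: "'a \<Rightarrow> real" where "\<And>v. v \<in> pverts G \<Longrightarrow> x v \<ge> 0" and "\<exists>v\<in>pverts G. x v > 0"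
    and "\<And>v. v \<in> pverts G \<Longrightarrow> (\<Sum>w\<in>nbrs G v. x w) = graph_spectral_radius G * x v"
proof -
  let ?V = "pverts G" and ?\<rho> = "graph_spectral_radius G"
  have sym: "of_bool (w \<in> nbrs G v) = (of_bool (v \<in> nbrs G w) :: real)" for v w
    using nbrs_sym[OF G, of w v] by simp
  have nonneg: "(of_bool (w \<in> nbrs G v) :: real) \<ge> 0" for v w
    by simp
  obtain M :: real and x :: "'a \<Rightarrow> real" where x: "\<And>v. v \<in> ?V \<Longrightarrow> x v \<ge> 0" "\<exists>v\<in>?V. x v > 0"
    and eig: "\<And>v. v \<in> ?V \<Longrightarrow> (\<Sum>w\<in>?V. of_bool (w \<in> nbrs G v) * x w) = M * x v"
    and bound: "\<And>y. (\<Sum>v\<in>?V. y v * (\<Sum>w\<in>?V. of_bool (w \<in> nbrs G v) * y w)) \<le> M * (\<Sum>v\<in>?V. (y v)\<^sup>2)"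
    by (rule nonneg_symmetric_form_nonneg_maximizer
      [OF finite_pverts[OF G] ne, of "\<lambda>v w. of_bool (w \<in> nbrs G v)", OF sym nonneg])
      (rule that; assumption)
  note eig = eig[unfolded sum_nbrs_eq[OF G]] and bound = bound[unfolded sum_nbrs_eq[OF G]]
  have "complex_of_real M \<in> spectrum (adjacency_matrix G)"
    unfolding spectrum_adjacency_matrix[OF G]
    using x(2) eig by (intro exI[of _ "\<lambda>v. complex_of_real (x v)"])
      (force simp flip: of_real_sum of_real_mult)
  from graph_spectral_radius(2)[OF G ne this] have "M \<le> ?\<rho>" by simp
  moreover have "?\<rho> \<le> M"
  proof -
    from graph_spectral_radius(1)[OF G ne] obtain \<mu> where \<mu>: "norm \<mu> = ?\<rho>"
      and "\<mu> \<in> spectrum (adjacency_matrix G)" by auto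
    then obtain f where f: "\<exists>v\<in>?V. f v \<noteq> 0" "\<And>v. v \<in> ?V \<Longrightarrow> (\<Sum>w\<in>nbrs G v. f w) = \<mu> * f v"
      unfolding spectrum_adjacency_matrix[OF G] by blast
    have "?\<rho> * (\<Sum>v\<in>?V. (norm (f v))\<^sup>2) = (\<Sum>v\<in>?V. norm (f v) * norm (\<Sum>w\<in>nbrs G v. f w))"
      unfolding sum_distrib_left
      by (rule sum.cong) (auto simp: f(2) norm_mult \<mu> power2_eq_square)
    also have "\<dots> \<le> (\<Sum>v\<in>?V. norm (f v) * (\<Sum>w\<in>nbrs G v. norm (f w)))"
      by (intro sum_mono mult_left_mono norm_sum) auto
    also have "\<dots> \<le> M * (\<Sum>v\<in>?V. (norm (f v))\<^sup>2)" by (rule bound)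
    finally have "?\<rho> * (\<Sum>v\<in>?V. (norm (f v))\<^sup>2) \<le> M * (\<Sum>v\<in>?V. (norm (f v))\<^sup>2)" .
    moreover obtain v where "v \<in> ?V" "f v \<noteq> 0" using f(1) by blast
    then have "(\<Sum>v\<in>?V. (norm (f v))\<^sup>2) > 0"
      using finite_pverts[OF G] by (intro sum_pos2[of _ v]) auto
    ultimately show ?thesis by simp
  qed
  ultimately show ?thesis using that[of x] x eig by simp
qed

text \<open>Two eigenvectors of a symmetric matrix with nonzero inner product share their eigenvalue.\<close>

lemma graph_spectral_radius_eqI:
  assumes G: "pair_graph G" and ne: "pverts G \<noteq> {}"
    and pos: "\<And>v. v \<in> pverts G \<Longrightarrow> z v > 0"
    and eig: "\<And>v. v \<in> pverts G \<Longrightarrow> (\<Sum>w\<in>nbrs G v. z w) = \<mu> * z v"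
  shows "graph_spectral_radius G = \<mu>"
proof -
  let ?V = "pverts G" and ?\<rho> = "graph_spectral_radius G"
  obtain x where x: "\<And>v. v \<in> ?V \<Longrightarrow> x v \<ge> 0" "\<exists>v\<in>?V. x v > 0"
    and xeig: "\<And>v. v \<in> ?V \<Longrightarrow> (\<Sum>w\<in>nbrs G v. x w) = ?\<rho> * x v"
    using ex_nonneg_eigenvector[OF G ne] by blast
  have "?\<rho> * (\<Sum>v\<in>?V. z v * x v) = (\<Sum>v\<in>?V. \<Sum>w\<in>?V. of_bool (w \<in> nbrs G v) * (z v * x w))"
    unfolding sum_nbrs_eq[OF G] sum_distrib_left[symmetric]
    unfolding sum_distrib_left by (rule sum.cong) (auto simp: xeig simp flip: sum_distrib_left)
  also have "\<dots> = (\<Sum>w\<in>?V. \<Sum>v\<in>?V. of_bool (v \<in> nbrs G w) * (x w * z v))"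
    using nbrs_sym[OF G] by (subst sum.swap) (auto intro!: sum.cong)
  also have "\<dots> = \<mu> * (\<Sum>v\<in>?V. z v * x v)"
    unfolding sum_nbrs_eq[OF G] sum_distrib_left[symmetric]
    unfolding sum_distrib_left by (rule sum.cong) (auto simp: eig simp flip: sum_distrib_left)
  finally have "?\<rho> * (\<Sum>v\<in>?V. z v * x v) = \<mu> * (\<Sum>v\<in>?V. z v * x v)" .
  moreover obtain v where "v \<in> ?V" "x v > 0" using x(2) by blast
  then have "(\<Sum>v\<in>?V. z v * x v) > 0"
    using finite_pverts[OF G] x(1) pos by (intro sum_pos2[of _ v]) (auto simp: less_imp_le)
  ultimately show ?thesis by simp
qed

subsection \<open>Isomorphisms, the fish and the extremal graphs\<close>

text \<open>\<open>digraph_iso\<close> asks for a map of arcs as well; as arcs are pairs of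
  vertices, \<open>map_prod f f\<close> serves.\<close>

lemma graph_isoI:
  assumes wf: "pair_wf_digraph G" and bij: "bij_betw f (pverts G) (pverts H)"
    and H: "parcs H \<subseteq> pverts H \<times> pverts H"
    and adj: "\<And>v w. v \<in> pverts G \<Longrightarrow> w \<in> pverts G \<Longrightarrow> (v, w) \<in> parcs G \<longleftrightarrow> (f v, f w) \<in> parcs H"
  shows "G \<cong>\<^sub>g H"
proof -
  define hom where
    "hom = \<lparr> iso_verts = f, iso_arcs = map_prod f f, iso_head = snd, iso_tail = fst \<rparr>"
  have G: "parcs G \<subseteq> pverts G \<times> pverts G"
    using pair_wf_digraph.in_arcsD1[OF wf] pair_wf_digraph.in_arcsD2[OF wf] by auto
  have inj: "inj_on f (pverts G)" and surj: "f ` pverts G = pverts H"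
    using bij by (auto simp: bij_betw_def)
  have "inj_on (map_prod f f) (parcs G)"
    by (rule inj_on_subset[OF map_prod_inj_on[OF inj inj] G])
  then have "pre_digraph.digraph_isomorphism (with_proj G) hom"
    unfolding pre_digraph.digraph_isomorphism_def
    using inj wf by (auto simp: hom_def wf_digraph_wp_iff)
  moreover have "parcs H = map_prod f f ` parcs G"
  proof
    show "map_prod f f ` parcs G \<subseteq> parcs H" using adj G by auto
    show "parcs H \<subseteq> map_prod f f ` parcs G"
    proof
      fix e assume e: "e \<in> parcs H"
      then obtain v w where "v \<in> pverts G" "w \<in> pverts G" "e = (f v, f w)"
        using H surj by (cases e) blast
      then show "e \<in> map_prod f f ` parcs G" using e adj by force
    qed
  qed
  then have "with_proj H = app_iso hom (with_proj G)"
    unfolding app_iso_def hom_def with_proj_def using surj by simp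
  ultimately show ?thesis unfolding digraph_iso_def by blast
qed

lemma graph_isoE:
  assumes iso: "G \<cong>\<^sub>g H" and G: "pair_graph G"
  obtains f where "bij_betw f (pverts G) (pverts H)"
    and "\<And>v. v \<in> pverts G \<Longrightarrow> bij_betw f (nbrs G v) (nbrs H (f v))"
proof -
  obtain hom where hom: "pre_digraph.digraph_isomorphism (with_proj G) hom"
    and H: "with_proj H = app_iso hom (with_proj G)"
    using iso unfolding digraph_iso_def by blast
  define f where "f = iso_verts hom"
  have inj: "inj_on f (pverts G)" and verts: "f ` pverts G = pverts H"
    using hom arg_cong[OF H, of verts]
    by (auto simp: pre_digraph.digraph_isomorphism_def f_def)
  \<comment> \<open>Arcs of \<open>with_proj\<close> are their own pairs of ends and an isomorphism
    respects tails and heads, so its arc map is forced.\<close>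
  have "iso_arcs hom e = map_prod f f e" if "e \<in> parcs G" for e
    using hom that arg_cong[OF H, of tail] arg_cong[OF H, of head]
    by (auto simp: pre_digraph.digraph_isomorphism_def f_def prod_eq_iff)
  then have arcs: "parcs H = map_prod f f ` parcs G"
    using arg_cong[OF H, of arcs] by (auto intro: rev_image_eqI)
  have nbrs: "nbrs H (f v) = f ` nbrs G v" if v: "v \<in> pverts G" for v
  proof -
    have "v' = v" if "(v', w) \<in> parcs G" "f v' = f v" for v' w
      using that v inj nbrs_subset_verts[OF G, of w] nbrs_sym[OF G, of w v']
      by (auto simp: nbrs_def dest: inj_onD)
    then show ?thesis unfolding nbrs_def arcs by force
  qed
  have "bij_betw f (nbrs G v) (nbrs H (f v))" if "v \<in> pverts G" for v
    using inj_on_subset[OF inj nbrs_subset_verts[OF G]] nbrs[OF that] by (simp add: bij_betw_def)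
  then show ?thesis using that[of f] inj verts by (auto simp: bij_betw_def)
qed

section \<open>Finding a fish; star cones up to isomorphism\<close>

lemma converse_insert_pair: "(insert (a, b) r)\<inverse> = insert (b, a) (r\<inverse>)"
  by auto

lemma fish_graph_simps:
  "pverts fish_graph = {0, 1, 2, 3, 4, 5}"
  "parcs fish_graph = {(0, 1), (1, 2), (2, 3), (3, 0), (0, 4), (4, 5), (5, 0),
    (1, 0), (2, 1), (3, 2), (0, 3), (4, 0), (5, 4), (0, 5)}"
  unfolding fish_graph_def Let_def pair_pre_digraph.simps
  by (simp_all only: converse_insert_pair converse_empty Un_insert_left Un_empty_left)

text \<open>\<open>u\<close> is the vertex shared by the 4-cycle \<open>u, a, w, b\<close> and the
  triangle \<open>u, p, q\<close>; the list gives the images of the vertices 0 to 5 of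
  \<open>fish_graph\<close> in order.\<close>

lemma contains_fishI:
  assumes G: "pair_graph G"
    and dist: "distinct [u, a, w, b, p, q]"
    and edges: "a \<in> nbrs G u" "w \<in> nbrs G a" "b \<in> nbrs G w" "u \<in> nbrs G b"
      "p \<in> nbrs G u" "q \<in> nbrs G p" "u \<in> nbrs G q"
  shows "contains_graph G fish_graph"
proof -
  define f where "f n = [u, a, w, b, p, q] ! n" for n
  define K where "K = \<lparr> pverts = f ` pverts fish_graph, parcs = map_prod f f ` parcs fish_graph \<rparr>"
  have f: "f 0 = u" "f 1 = a" "f (Suc 0) = a" "f 2 = w" "f 3 = b" "f 4 = p" "f 5 = q"
    unfolding f_def by (simp_all add: numeral_eq_Suc)
  have inj: "inj_on f (pverts fish_graph)"
  proof -
    have "distinct (map f [0, 1, 2, 3, 4, 5])" using dist by (simp only: list.map f)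
    then show ?thesis unfolding distinct_map fish_graph_simps by simp
  qed
  have fish: "parcs fish_graph \<subseteq> pverts fish_graph \<times> pverts fish_graph"
    unfolding fish_graph_simps by simp
  then have wf: "pair_wf_digraph fish_graph" by (intro pair_wf_digraph.intro) auto
  have wfK: "pair_wf_digraph K" using fish by (intro pair_wf_digraph.intro) (auto simp: K_def)
  have wfG: "pair_wf_digraph G"
    using G by (simp add: pair_graph_def pair_digraph_def pair_fin_digraph_def)
  have "u \<in> nbrs G a" "a \<in> nbrs G w" "w \<in> nbrs G b" "b \<in> nbrs G u"
      "u \<in> nbrs G p" "p \<in> nbrs G q" "q \<in> nbrs G u"
    using edges nbrs_sym[OF G] by blast+
  with edges have arcsK: "parcs K \<subseteq> parcs G"
    unfolding K_def fish_graph_simps by (simp add: f nbrs_def)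
  have vertsK: "pverts K \<subseteq> pverts G"
    using edges nbrs_subset_verts[OF G] unfolding K_def fish_graph_simps by (simp add: f) blast
  have "fish_graph \<cong>\<^sub>g K"
  proof (rule graph_isoI[OF wf, of f])
    show "bij_betw f (pverts fish_graph) (pverts K)" using inj by (simp add: K_def bij_betw_def)
    show "parcs K \<subseteq> pverts K \<times> pverts K" using fish by (auto simp: K_def)
    fix i j assume ij: "i \<in> pverts fish_graph" "j \<in> pverts fish_graph"
    show "(i, j) \<in> parcs fish_graph \<longleftrightarrow> (f i, f j) \<in> parcs K"
    proof
      assume "(f i, f j) \<in> parcs K"
      then obtain i' j' where "(i', j') \<in> parcs fish_graph" "f i' = f i" "f j' = f j"
        by (auto simp: K_def)
      moreover from this have "i' = i" "j' = j" using fish ij inj_onD[OF inj] by blast+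
      ultimately show "(i, j) \<in> parcs fish_graph" by simp
    qed (force simp: K_def)
  qed
  moreover have "subgraph (with_proj K) (with_proj G)"
    unfolding subgraph_def compatible_def wf_digraph_wp_iff using arcsK vertsK wfK wfG by simp
  ultimately show ?thesis unfolding contains_graph_def by blast
qed

text \<open>
  Cones over the disjoint union of a star (centre \<open>c\<close>, leaves \<open>L\<close>) and of isolated vertices \<open>P\<close>: the
  book is the case \<open>P = {}\<close>, the extremal graph of the theorem the case \<open>card P = 2\<close>.
\<close>

definition star_cone :: "'a pair_pre_digraph \<Rightarrow> 'a \<Rightarrow> 'a \<Rightarrow> 'a set \<Rightarrow> 'a set \<Rightarrow> bool" where
  "star_cone G u c L P \<longleftrightarrow>
    finite L \<and> finite P \<and> u \<noteq> c \<and> u \<notin> L \<union> P \<and> c \<notin> L \<union> P \<and> L \<inter> P = {} \<and>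
    pverts G = {u, c} \<union> L \<union> P \<and> parcs G \<subseteq> pverts G \<times> pverts G \<and>
    nbrs G u = {c} \<union> L \<union> P \<and> nbrs G c = {u} \<union> L \<and>
    (\<forall>l\<in>L. nbrs G l = {u, c}) \<and> (\<forall>p\<in>P. nbrs G p = {u})"

text \<open>A star cone has all its neighbourhoods prescribed, so arbitrary bijections from
  \<open>L\<close> to \<open>L'\<close> and from \<open>P\<close> to \<open>P'\<close>, extended by
  sending \<open>u\<close> to \<open>u'\<close> and \<open>c\<close> to \<open>c'\<close>, preserve
  adjacency.\<close>

lemma star_cone_iso:
  assumes G: "pair_graph G" "star_cone G u c L P" and H: "star_cone H u' c' L' P'"
    and card: "card L = card L'" "card P = card P'"
  shows "G \<cong>\<^sub>g H"
proof -
  note dG = G(2)[unfolded star_cone_def] and dH = H[unfolded star_cone_def]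
  have G': "u \<noteq> c" "u \<notin> L" "u \<notin> P" "c \<notin> L" "c \<notin> P" "L \<inter> P = {}" "pverts G = {u, c} \<union> (L \<union> P)"
    and nG: "nbrs G u = {c} \<union> L \<union> P" "nbrs G c = {u} \<union> L" "\<And>l. l \<in> L \<Longrightarrow> nbrs G l = {u, c}"
      "\<And>p. p \<in> P \<Longrightarrow> nbrs G p = {u}"
    using dG by simp_all
  have H': "u' \<noteq> c'" "u' \<notin> L'" "u' \<notin> P'" "c' \<notin> L'" "c' \<notin> P'" "L' \<inter> P' = {}"
      "pverts H = {u', c'} \<union> (L' \<union> P')"
    and nH: "nbrs H u' = {c'} \<union> L' \<union> P'" "nbrs H c' = {u'} \<union> L'" "\<And>l. l \<in> L' \<Longrightarrow> nbrs H l = {u', c'}"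
      "\<And>p. p \<in> P' \<Longrightarrow> nbrs H p = {u'}"
    using dH by simp_all
  have fin: "finite L" "finite P" "finite L'" "finite P'" using dG dH by simp_all
  obtain g where g: "bij_betw g L L'"
    using finite_same_card_bij[OF fin(1,3) card(1)] by blast
  obtain h where h: "bij_betw h P P'"
    using finite_same_card_bij[OF fin(2,4) card(2)] by blast
  define f where "f v = (if v = u then u' else if v = c then c' else if v \<in> L then g v else h v)" for v
  have f: "f u = u'" "f c = c'"
    using G' by (auto simp: f_def)
  have fL: "f l = g l" if "l \<in> L" for l
    using G' that by (auto simp: f_def)
  have fP: "f p = h p" if "p \<in> P" for p
    using G' that by (auto simp: f_def)
  have bL: "bij_betw f L L'" using bij_betw_cong[of L f g, OF fL] g by simp
  have bP: "bij_betw f P P'" using bij_betw_cong[of P f h, OF fP] h by simp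
  have buc: "bij_betw f {u, c} {u', c'}" using G'(1) H'(1) f by (simp add: bij_betw_def)
  have "bij_betw f ({u, c} \<union> (L \<union> P)) ({u', c'} \<union> (L' \<union> P'))"
    by (intro bij_betw_combine bL bP buc) (use H' in auto)
  then have bij: "bij_betw f (pverts G) (pverts H)" using G'(7) H'(7) by simp
  have gL: "f l \<in> L'" if "l \<in> L" for l using bL that by (auto simp: bij_betw_def)
  have hP: "f p \<in> P'" if "p \<in> P" for p using bP that by (auto simp: bij_betw_def)
  show ?thesis
  proof (rule graph_isoI[OF _ bij])
    show "pair_wf_digraph G"
      using G(1) by (simp add: pair_graph_def pair_digraph_def pair_fin_digraph_def)
    show "parcs H \<subseteq> pverts H \<times> pverts H" using dH by (elim conjE)
    fix v w assume v: "v \<in> pverts G" and w: "w \<in> pverts G"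
    have inj: "f w = f w' \<longleftrightarrow> w = w'" if "w' \<in> pverts G" for w'
      using inj_on_eq_iff[OF bij_betw_imp_inj_on[OF bij] w that] .
    have uc: "f w = u' \<longleftrightarrow> w = u" "f w = c' \<longleftrightarrow> w = c"
      using inj[of u] inj[of c] G'(7) f by simp_all
    consider "w = u" | "w = c" | "w \<in> L" | "w \<in> P" using w G'(7) by blast
    then have mem: "(f w \<in> L' \<longleftrightarrow> w \<in> L) \<and> (f w \<in> P' \<longleftrightarrow> w \<in> P)"
      by cases (use G' H' f gL[of w] hP[of w] in auto)
    consider "v = u" | "v = c" | "v \<in> L" | "v \<in> P" using v G'(7) by blast
    then have "w \<in> nbrs G v \<longleftrightarrow> f w \<in> nbrs H (f v)"
      by cases (simp_all add: f nG nH gL hP uc mem)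
    then show "(v, w) \<in> parcs G \<longleftrightarrow> (f v, f w) \<in> parcs H" by (simp add: nbrs_def)
  qed
qed

section \<open>Unions and joins, and the two named graphs as star cones\<close>

lemma parcs_disjoint_union:
  "(Inl a, Inl a') \<in> parcs (disjoint_union A B) \<longleftrightarrow> (a, a') \<in> parcs A"
  "(Inr b, Inr b') \<in> parcs (disjoint_union A B) \<longleftrightarrow> (b, b') \<in> parcs B"
  "(Inl a, Inr b) \<notin> parcs (disjoint_union A B)"
  "(Inr b, Inl a) \<notin> parcs (disjoint_union A B)"
  unfolding disjoint_union_def by force+

lemma parcs_graph_join:
  "(Inl a, Inl a') \<in> parcs (graph_join A B) \<longleftrightarrow> (a, a') \<in> parcs A"
  "(Inr b, Inr b') \<in> parcs (graph_join A B) \<longleftrightarrow> (b, b') \<in> parcs B"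
  "(Inl a, Inr b) \<in> parcs (graph_join A B) \<longleftrightarrow> a \<in> pverts A \<and> b \<in> pverts B"
  "(Inr b, Inl a) \<in> parcs (graph_join A B) \<longleftrightarrow> a \<in> pverts A \<and> b \<in> pverts B"
  unfolding graph_join_def by (auto simp: parcs_disjoint_union)

lemma nbrs_disjoint_union:
  "nbrs (disjoint_union A B) (Inl a) = Inl ` nbrs A a"
  "nbrs (disjoint_union A B) (Inr b) = Inr ` nbrs B b"
proof -
  have "x \<in> nbrs (disjoint_union A B) (Inl a) \<longleftrightarrow> x \<in> Inl ` nbrs A a"
    "x \<in> nbrs (disjoint_union A B) (Inr b) \<longleftrightarrow> x \<in> Inr ` nbrs B b" for x
    by (cases x; auto simp: nbrs_def parcs_disjoint_union)+
  then show "nbrs (disjoint_union A B) (Inl a) = Inl ` nbrs A a"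
    "nbrs (disjoint_union A B) (Inr b) = Inr ` nbrs B b" by blast+
qed

lemma nbrs_graph_join:
  "a \<in> pverts A \<Longrightarrow> nbrs (graph_join A B) (Inl a) = Inl ` nbrs A a \<union> Inr ` pverts B"
  "b \<in> pverts B \<Longrightarrow> nbrs (graph_join A B) (Inr b) = Inr ` nbrs B b \<union> Inl ` pverts A"
proof -
  have "x \<in> nbrs (graph_join A B) (Inl a) \<longleftrightarrow> x \<in> Inl ` nbrs A a \<union> Inr ` pverts B"
    if "a \<in> pverts A" for x
    using that by (cases x) (auto simp: nbrs_def parcs_graph_join)
  moreover have "x \<in> nbrs (graph_join A B) (Inr b) \<longleftrightarrow> x \<in> Inr ` nbrs B b \<union> Inl ` pverts A"
    if "b \<in> pverts B" for x
    using that by (cases x) (auto simp: nbrs_def parcs_graph_join)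
  ultimately show
    "a \<in> pverts A \<Longrightarrow> nbrs (graph_join A B) (Inl a) = Inl ` nbrs A a \<union> Inr ` pverts B"
    "b \<in> pverts B \<Longrightarrow> nbrs (graph_join A B) (Inr b) = Inr ` nbrs B b \<union> Inl ` pverts A"
    by blast+
qed

lemma parcs_disjoint_union_subset:
  assumes "parcs A \<subseteq> pverts A \<times> pverts A" "parcs B \<subseteq> pverts B \<times> pverts B"
  shows "parcs (disjoint_union A B) \<subseteq> pverts (disjoint_union A B) \<times> pverts (disjoint_union A B)"
  using assms unfolding disjoint_union_def by auto

lemma parcs_graph_join_subset:
  assumes "parcs A \<subseteq> pverts A \<times> pverts A" "parcs B \<subseteq> pverts B \<times> pverts B"
  shows "parcs (graph_join A B) \<subseteq> pverts (graph_join A B) \<times> pverts (graph_join A B)"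
  using parcs_disjoint_union_subset[OF assms]
  unfolding graph_join_def disjoint_union_def by auto

lemma complete_graph_simps:
  "pverts (complete_graph n) = {..<n}" "nbrs (complete_graph n) i = {j. i < n \<and> j < n \<and> j \<noteq> i}"
  "parcs (complete_graph n) \<subseteq> pverts (complete_graph n) \<times> pverts (complete_graph n)"
  unfolding complete_graph_def nbrs_def by auto

lemma star_graph_simps:
  "pverts (star_graph r) = {0..r}" "nbrs (star_graph r) 0 = {1..r}"
  "i \<in> {1..r} \<Longrightarrow> nbrs (star_graph r) i = {0}"
  "parcs (star_graph r) \<subseteq> pverts (star_graph r) \<times> pverts (star_graph r)"
  unfolding star_graph_def nbrs_def by auto

lemma copies_complete_graph_1_simps:
  "pverts (copies k (complete_graph (Suc 0))) = {..<k} \<times> {0}"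
  "nbrs (copies k (complete_graph (Suc 0))) p = {}"
  "parcs (copies k (complete_graph (Suc 0))) = {}"
  unfolding copies_def complete_graph_def nbrs_def by auto

lemma star_cone_join_star:
  "star_cone (graph_join (complete_graph 1) (disjoint_union (star_graph r) (copies s (complete_graph 1))))
    (Inl 0) (Inr (Inl 0)) (Inr ` Inl ` {1..r}) (Inr ` Inr ` ({..<s} \<times> {0}))"
proof -
  let ?B = "disjoint_union (star_graph r) (copies s (complete_graph 1))"
  have B: "pverts ?B = insert (Inl 0) (Inl ` {1..r} \<union> Inr ` ({..<s} \<times> {0}))"
    unfolding disjoint_union_def by (auto simp: star_graph_simps copies_complete_graph_1_simps image_iff)
  let ?J = "graph_join (complete_graph 1) ?B"
  have B_arcs: "parcs ?B \<subseteq> pverts ?B \<times> pverts ?B"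
    by (rule parcs_disjoint_union_subset[OF star_graph_simps(4)])
      (simp add: copies_complete_graph_1_simps)
  have arcs: "parcs ?J \<subseteq> pverts ?J \<times> pverts ?J"
    by (rule parcs_graph_join_subset[OF complete_graph_simps(3) B_arcs])
  have one: "pverts (complete_graph 1) = {0}" "pverts (complete_graph (Suc 0)) = {0}"
    "nbrs (complete_graph (Suc 0)) 0 = {}"
    by (auto simp: complete_graph_simps)
  have verts: "pverts ?J = {Inl 0, Inr (Inl 0)} \<union> Inr ` Inl ` {1..r} \<union> Inr ` Inr ` ({..<s} \<times> {0})"
    unfolding graph_join_def pair_pre_digraph.simps B one Plus_def by (simp add: image_Un insert_commute)
  have "nbrs ?J (Inl 0) = {Inr (Inl 0)} \<union> Inr ` Inl ` {1..r} \<union> Inr ` Inr ` ({..<s} \<times> {0})"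
    using nbrs_graph_join(1)[of 0 "complete_graph 1" ?B] unfolding B by (simp add: one image_Un)
  moreover have "nbrs ?J (Inr (Inl 0)) = {Inl 0} \<union> Inr ` Inl ` {1..r}"
    using nbrs_graph_join(2)[of "Inl 0" ?B "complete_graph 1"] unfolding B
    by (simp add: one nbrs_disjoint_union star_graph_simps)
  moreover have "nbrs ?J (Inr (Inl i)) = {Inl 0, Inr (Inl 0)}" if "i \<in> {1..r}" for i
    using nbrs_graph_join(2)[of "Inl i" ?B "complete_graph 1"] that star_graph_simps(3)[OF that]
    unfolding B by (simp add: one nbrs_disjoint_union insert_commute)
  moreover have "nbrs ?J (Inr (Inr p)) = {Inl 0}" if "p \<in> {..<s} \<times> {0}" for p
    using nbrs_graph_join(2)[of "Inr p" ?B "complete_graph 1"] that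
    unfolding B by (simp add: one nbrs_disjoint_union copies_complete_graph_1_simps)
  ultimately show ?thesis
    unfolding star_cone_def using arcs verts by (intro conjI ballI) auto
qed

text \<open>One end of the spine is taken as apex and the other as centre of a star whose leaves are
  the pages, which leaves nothing for \<open>P\<close>.\<close>

lemma star_cone_book:
  "star_cone (graph_join (complete_graph 2) (copies k (complete_graph 1)))
    (Inl 0) (Inl 1) (Inr ` ({..<k} \<times> {0})) {}"
proof -
  let ?B = "copies k (complete_graph 1)"
  have "parcs ?B \<subseteq> pverts ?B \<times> pverts ?B"
    by (simp add: copies_complete_graph_1_simps)
  from parcs_graph_join_subset[OF complete_graph_simps(3) this]
  have "parcs (graph_join (complete_graph 2) ?B)
    \<subseteq> pverts (graph_join (complete_graph 2) ?B) \<times> pverts (graph_join (complete_graph 2) ?B)" .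
  moreover have "pverts (graph_join (complete_graph 2) ?B) = {Inl 0, Inl 1} \<union> Inr ` ({..<k} \<times> {0})"
    unfolding graph_join_def
    by (auto simp: complete_graph_simps copies_complete_graph_1_simps less_2_cases_iff image_iff)
  ultimately show ?thesis
    unfolding star_cone_def
    by (auto simp: nbrs_graph_join complete_graph_simps copies_complete_graph_1_simps less_2_cases_iff)
qed

section \<open>The largest root of the quartic\<close>

text \<open>The comparison point is the positive root \<open>x0\<close> of
  \<open>x^2 - x = m - 2\<close>, where the quartic takes the value -1. A sign change to the right
  puts the largest root strictly beyond \<open>x0\<close>, from which it inherits both
  bounds.\<close>

lemma lambda_tilde:
  fixes m :: nat
  assumes m: "58 \<le> m"
  defines "l \<equiv> lambda_tilde m"
  shows "l ^ 4 - real m * l\<^sup>2 - (real m - 3) * l + real m - 3 = 0"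
    and "l > 8" and "l\<^sup>2 - l > real m - 2"
proof -
  define f where "f x = x ^ 4 - real m * x ^ 2 - (real m - 3) * x + real m - 3" for x :: real
  have "finite {x. poly [:real m - 3, - (real m - 3), - real m, 0, 1:] x = 0}"
    by (rule poly_roots_finite) simp
  moreover have "poly [:real m - 3, - (real m - 3), - real m, 0, 1:] x = f x" for x
    by (simp add: f_def algebra_simps power2_eq_square power4_eq_xxxx)
  ultimately have fin: "finite {x. f x = 0}" by simp
  have m': "real m \<ge> 58" using m by simp
  define s where "s = sqrt (4 * real m - 7)"
  define x0 where "x0 = (1 + s) / 2"
  have s2: "s * s = 4 * real m - 7" unfolding s_def using m' by simp
  \<comment> \<open>\<open>58 \<le> m\<close> says exactly that \<open>4 * m - 7\<close> is at least
    \<open>15^2\<close>; this makes \<open>x0\<close> at least 8.\<close>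
  have "s \<ge> 15" unfolding s_def using m' by (intro real_le_rsqrt) simp
  then have x0: "x0 \<ge> 8" by (simp add: x0_def)
  have x0_sq: "x0 * x0 = x0 + real m - 2"
    using s2 by (simp add: x0_def field_simps)
  have "f x0 = -1"
  proof -
    have "f x0 = (x0 * x0) * (x0 * x0) - real m * (x0 * x0) - (real m - 3) * x0 + real m - 3"
      by (simp add: f_def power2_eq_square power4_eq_xxxx)
    also have "\<dots> = -1"
      unfolding x0_sq using x0_sq by (simp add: algebra_simps)
    finally show ?thesis .
  qed
  moreover have "f (real m) \<ge> 0"
  proof -
    have "f (real m) = real m * real m * (real m * (real m - 1) - 1) + 4 * real m - 3"
      by (simp add: f_def power2_eq_square power4_eq_xxxx algebra_simps)
    moreover have "real m * (real m - 1) \<ge> 1 * 1" using m' by (intro mult_mono) auto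
    then have "real m * real m * (real m * (real m - 1) - 1) \<ge> 0" by simp
    ultimately show ?thesis using m' by linarith
  qed
  moreover have "x0 \<le> real m"
  proof (rule ccontr)
    assume "\<not> ?thesis"
    then have "x0 * (x0 - 1) > real m * 1" using x0 m' by (intro mult_strict_mono) auto
    then show False using x0_sq by (simp add: algebra_simps)
  qed
  moreover have "continuous_on {x0..real m} f"
    unfolding f_def by (intro continuous_intros)
  ultimately obtain y where y: "x0 \<le> y" "f y = 0"
    using IVT'[of f x0 0 "real m"] by force
  have l: "l = Max {x. f x = 0}"
    unfolding l_def lambda_tilde_def f_def ..
  have "f l = 0" using Max_in[OF fin] y unfolding l by blast
  then show "l ^ 4 - real m * l\<^sup>2 - (real m - 3) * l + real m - 3 = 0" by (simp add: f_def)
  have "y \<le> l" unfolding l using fin y by simp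
  with y \<open>f x0 = -1\<close> \<open>f l = 0\<close> have "x0 < l" by (cases "x0 = l") auto
  then show "l > 8" using x0 by simp
  \<comment> \<open>The product is the difference between the values of \<open>t^2 - t\<close> at
    \<open>l\<close> and at \<open>x0\<close>.\<close>
  have "(l - x0) * (l + x0 - 1) > 0" using \<open>x0 < l\<close> x0 by simp
  then show "l\<^sup>2 - l > real m - 2"
    using x0_sq by (simp add: power2_eq_square algebra_simps)
qed

section \<open>The spectral radius of the extremal graph\<close>

text \<open>The vector is constant on each of the classes \<open>u\<close>, \<open>c\<close>,
  \<open>L\<close>, \<open>P\<close>. With value 1 at \<open>u\<close>, the equations on
  \<open>L\<close> and \<open>P\<close> fix the values there, the one at \<open>c\<close> fixes
  \<open>C\<close>, and the one at \<open>u\<close> then amounts to \<open>root\<close>.\<close>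

lemma star_cone_pos_eigenvector:
  fixes l :: real
  assumes H: "star_cone H u c L P"
    and l: "l > 0" "l\<^sup>2 > real (card L)"
    and root: "(l\<^sup>2 - real (card L)) * (l\<^sup>2 - real (card L) - real (card P)) = (l + real (card L))\<^sup>2"
  obtains z where "\<And>v. v \<in> pverts H \<Longrightarrow> z v > 0"
    and "\<And>v. v \<in> pverts H \<Longrightarrow> (\<Sum>w\<in>nbrs H v. z w) = l * z v"
proof -
  define r where "r = real (card L)"
  define s where "s = real (card P)"
  define C where "C = (l + r) / (l\<^sup>2 - r)"
  note dH = H[unfolded star_cone_def]
  have H': "u \<noteq> c" "u \<notin> L" "u \<notin> P" "c \<notin> L" "c \<notin> P" "L \<inter> P = {}" "pverts H = {u, c} \<union> (L \<union> P)"
    and fin: "finite L" "finite P"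
    and nH: "nbrs H u = {c} \<union> L \<union> P" "nbrs H c = {u} \<union> L" "\<And>x. x \<in> L \<Longrightarrow> nbrs H x = {u, c}"
      "\<And>p. p \<in> P \<Longrightarrow> nbrs H p = {u}"
    using dH by simp_all
  define z where "z v = (if v = u then 1 else if v = c then C else if v \<in> L then (1 + C) / l else 1 / l)" for v
  have z: "z u = 1" "z c = C"
    using H' by (auto simp: z_def)
  have zL: "z x = (1 + C) / l" if "x \<in> L" for x
    using H' that by (auto simp: z_def)
  have zP: "z p = 1 / l" if "p \<in> P" for p
    using H' that by (auto simp: z_def)
  have "r \<ge> 0" by (simp add: r_def)
  have D: "l\<^sup>2 - r > 0" using l by (simp add: r_def)
  have C: "C > 0" using l D \<open>r \<ge> 0\<close> by (simp add: C_def)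
  have Ceq: "C * (l\<^sup>2 - r) = l + r" using D by (simp add: C_def)
  have ueq: "C * (l + r) = l\<^sup>2 - r - s"
  proof -
    have "C * (l + r) * (l\<^sup>2 - r) = C * (l\<^sup>2 - r) * (l + r)" by (simp only: mult_ac)
    also have "\<dots> = (l\<^sup>2 - r - s) * (l\<^sup>2 - r)"
      unfolding Ceq using root by (simp add: r_def s_def power2_eq_square mult.commute)
    finally show ?thesis using D by simp
  qed
  have sumL: "(\<Sum>w\<in>L. z w) = r * ((1 + C) / l)" by (simp add: zL r_def)
  have sumP: "(\<Sum>w\<in>P. z w) = s * (1 / l)" by (simp add: zP s_def)
  have "z v > 0" if "v \<in> pverts H" for v
    using that C l H'(7) by (auto simp: z_def)
  moreover have "(\<Sum>w\<in>nbrs H v. z w) = l * z v" if v: "v \<in> pverts H" for v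
  proof -
    consider "v = u" | "v = c" | "v \<in> L" | "v \<in> P" using v H'(7) by blast
    then show ?thesis
    proof cases
      case 1
      have "(\<Sum>w\<in>nbrs H v. z w) = C + (r * ((1 + C) / l) + s * (1 / l))"
        using 1 nH(1) H' fin z sumL sumP by (simp add: sum.union_disjoint)
      also have "\<dots> = l * z v"
        using ueq l 1 z by (simp add: field_simps power2_eq_square)
      finally show ?thesis .
    next
      case 2
      have "(\<Sum>w\<in>nbrs H v. z w) = 1 + r * ((1 + C) / l)"
        using 2 nH(2) H' fin z sumL by simp
      also have "\<dots> = l * z v"
        using Ceq l 2 z by (simp add: field_simps power2_eq_square)
      finally show ?thesis .
    next
      case 3
      then show ?thesis using nH(3) H' z zL l by simp
    next
      case 4
      then show ?thesis using nH(4) z zP l by simp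
    qed
  qed
  ultimately show ?thesis using that by blast
qed

lemma graph_spectral_radius_iso_eqI:
  assumes G: "pair_graph G" and ne: "pverts G \<noteq> {}" and iso: "G \<cong>\<^sub>g H"
    and pos: "\<And>v. v \<in> pverts H \<Longrightarrow> z v > 0"
    and eig: "\<And>v. v \<in> pverts H \<Longrightarrow> (\<Sum>w\<in>nbrs H v. z w) = \<mu> * z v"
  shows "graph_spectral_radius G = \<mu>"
proof -
  obtain f where f: "bij_betw f (pverts G) (pverts H)"
    and nbrs: "\<And>v. v \<in> pverts G \<Longrightarrow> bij_betw f (nbrs G v) (nbrs H (f v))"
    using graph_isoE[OF iso G] by blast
  have fv: "f v \<in> pverts H" if "v \<in> pverts G" for v
    using f that by (auto simp: bij_betw_def)
  show ?thesis
  proof (rule graph_spectral_radius_eqI[OF G ne])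
    fix v assume v: "v \<in> pverts G"
    show "z (f v) > 0" using pos fv[OF v] by blast
    show "(\<Sum>w\<in>nbrs G v. z (f w)) = \<mu> * z (f v)"
      using sum.reindex_bij_betw[OF nbrs[OF v], of z] eig[OF fv[OF v]] by simp
  qed
qed

lemma graph_spectral_radius_extremal:
  fixes G :: "'a pair_pre_digraph"
  assumes m: "58 \<le> m" "odd m" and G: "pair_graph G" "pverts G \<noteq> {}"
    and iso: "G \<cong>\<^sub>g graph_join (complete_graph 1)
        (disjoint_union (star_graph ((m - 3) div 2)) (copies 2 (complete_graph 1)))"
  shows "graph_spectral_radius G = lambda_tilde m"
proof -
  define r where "r = (m - 3) div 2"
  define l where "l = lambda_tilde m"
  have mr: "real m = 2 * real r + 3"
  proof -
    have "m = 2 * r + 3" unfolding r_def using m by presburger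
    then show ?thesis by simp
  qed
  note l = lambda_tilde[OF m(1), folded l_def]
  have L: "card (Inr ` Inl ` {1..r} :: (nat + nat + nat \<times> nat) set) = r"
    by (simp add: card_image)
  have P: "card (Inr ` Inr ` ({..<2} \<times> {0}) :: (nat + nat + nat \<times> nat) set) = 2"
    by (simp add: card_image card_cartesian_product)
  have "l\<^sup>2 > real r" using l(2,3) mr by simp
  \<comment> \<open>With two pendant vertices and \<open>m = 2 * r + 3\<close> this expands to the
    quartic.\<close>
  moreover have "(l\<^sup>2 - real r) * (l\<^sup>2 - real r - real 2) = (l + real r)\<^sup>2"
    using l(1) unfolding mr by (simp add: algebra_simps power2_eq_square power4_eq_xxxx)
  ultimately obtain z :: "nat + nat + nat \<times> nat \<Rightarrow> real" where
    "\<And>v. v \<in> pverts (graph_join (complete_graph 1)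
        (disjoint_union (star_graph r) (copies 2 (complete_graph 1)))) \<Longrightarrow> z v > 0"
    "\<And>v. v \<in> pverts (graph_join (complete_graph 1)
        (disjoint_union (star_graph r) (copies 2 (complete_graph 1)))) \<Longrightarrow>
      (\<Sum>w\<in>nbrs (graph_join (complete_graph 1)
        (disjoint_union (star_graph r) (copies 2 (complete_graph 1)))) v. z w) = l * z v"
    using star_cone_pos_eigenvector[OF star_cone_join_star[of r 2], of l, unfolded L P] l(2)
    by (metis (no_types, lifting) less_trans zero_less_numeral)
  from graph_spectral_radius_iso_eqI[OF G iso[folded r_def] this]
  show ?thesis by (simp add: l_def)
qed

subsection \<open>Fish-free graphs of large spectral radius\<close>

lemma card_parcs:
  assumes G: "pair_graph G"
  shows "card (parcs G) = 2 * card (edge_set G)"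
    and "card (parcs G) = (\<Sum>v\<in>pverts G. card (nbrs G v))"
proof -
  interpret pair_graph G by fact
  have fiber: "card {e \<in> parcs G. (\<lambda>(u, v). {u, v}) e = d} = 2" if "d \<in> edge_set G" for d
  proof -
    obtain a b where ab: "(a, b) \<in> parcs G" "d = {a, b}" using \<open>d \<in> edge_set G\<close> by (auto simp: edge_set_def)
    have ne: "a \<noteq> b" using no_loops'[OF ab(1)] .
    have ba: "(b, a) \<in> parcs G" using arcs_symmetric[OF ab(1)] .
    have iff: "e \<in> parcs G \<and> (\<lambda>(u, v). {u, v}) e = d \<longleftrightarrow> e = (a, b) \<or> e = (b, a)" for e
      unfolding ab(2) using ab(1) ba by (cases e) (simp add: doubleton_eq_iff, blast)
    have "card {e. e = (a, b) \<or> e = (b, a)} = card {(a, b), (b, a)}"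
      by (rule arg_cong[where f = card]) blast
    then show ?thesis unfolding iff using ne by simp
  qed
  have "card (parcs G) = (\<Sum>e\<in>parcs G. 1)" by simp
  also have "\<dots> = (\<Sum>d\<in>edge_set G. \<Sum>e\<in>{e \<in> parcs G. (\<lambda>(u, v). {u, v}) e = d}. 1)"
    unfolding edge_set_def by (rule sum.image_gen[OF pair_finite_arcs])
  also have "\<dots> = (\<Sum>d\<in>edge_set G. 2)"
    by (rule sum.cong[OF refl]) (simp only: sum_constant fiber of_nat_id mult_1_right)
  finally show "card (parcs G) = 2 * card (edge_set G)" by simp
  have "parcs G = Sigma (pverts G) (nbrs G)"
    by (auto simp: nbrs_def intro: in_arcsD1)
  then show "card (parcs G) = (\<Sum>v\<in>pverts G. card (nbrs G v))"
    using finite_pverts[OF G] finite_nbrs[OF G] by simp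
qed

text \<open>Both sides sum \<open>f w\<close> over the arcs from \<open>A\<close> to
  \<open>B\<close>, grouped by one end or the other.\<close>

lemma sum_sum_nbrs_swap:
  fixes f :: "'a \<Rightarrow> real"
  assumes G: "pair_graph G" and fin: "finite A" "finite B"
  shows "(\<Sum>v\<in>A. \<Sum>w\<in>nbrs G v \<inter> B. f w) = (\<Sum>w\<in>B. real (card (nbrs G w \<inter> A)) * f w)"
proof -
  have "(\<Sum>v\<in>A. \<Sum>w\<in>nbrs G v \<inter> B. f w) = (\<Sum>v\<in>A. \<Sum>w\<in>B. of_bool (w \<in> nbrs G v) * f w)"
    using fin by (intro sum.cong refl sum.mono_neutral_cong_left) auto
  also have "\<dots> = (\<Sum>w\<in>B. \<Sum>v\<in>A. of_bool (v \<in> nbrs G w) * f w)"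
    using nbrs_sym[OF G] by (subst sum.swap) (intro sum.cong, auto)
  also have "\<dots> = (\<Sum>w\<in>B. real (card (nbrs G w \<inter> A)) * f w)"
  proof (intro sum.cong refl)
    fix w
    have "(\<Sum>v\<in>A. of_bool (v \<in> nbrs G w) * f w) = (\<Sum>v\<in>nbrs G w \<inter> A. f w)"
      using fin by (intro sum.mono_neutral_cong_right) auto
    then show "(\<Sum>v\<in>A. of_bool (v \<in> nbrs G w) * f w) = real (card (nbrs G w \<inter> A)) * f w" by simp
  qed
  finally show ?thesis .
qed

text \<open>
  A vertex \<open>c\<close> of maximum degree has degree at least four, as there are at most six edges
  otherwise. An edge \<open>p q\<close> avoiding \<open>c\<close> would then miss two neighbours of \<open>c\<close>, a \<open>P\<^sub>3 \<union> K\<^sub>2\<close>.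
\<close>

lemma P3_K2_free_imp_star:
  fixes D :: "'a \<Rightarrow> 'a set"
  assumes fin: "finite N" and sub: "\<And>v. D v \<subseteq> N" and sym: "\<And>v w. w \<in> D v \<Longrightarrow> v \<in> D w"
    and irrefl: "\<And>v. v \<notin> D v"
    and free: "\<And>a b c p q. a \<in> D c \<Longrightarrow> b \<in> D c \<Longrightarrow> q \<in> D p \<Longrightarrow> distinct [a, b, c, p, q] \<Longrightarrow> False"
    and many: "12 < (\<Sum>v\<in>N. card (D v))" and path: "\<exists>c\<in>N. 2 \<le> card (D c)"
  obtains c where "c \<in> N" "4 \<le> card (D c)" "\<And>p q. q \<in> D p \<Longrightarrow> p = c \<or> q = c"
proof -
  have finD: "finite (D v)" for v using fin sub finite_subset by blast
  have NE: "N \<noteq> {}" using path by blast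
  have "Max ((\<lambda>v. card (D v)) ` N) \<in> (\<lambda>v. card (D v)) ` N"
    using fin NE by (intro Max_in) auto
  then obtain c where c: "c \<in> N" "card (D c) = Max ((\<lambda>v. card (D v)) ` N)" by auto
  have max: "card (D v) \<le> card (D c)" if "v \<in> N" for v
    unfolding c(2) using fin that by simp
  have two: "2 \<le> card (D c)" using path max le_trans by blast
  have few: "card (D c - {p, q}) \<le> 1" if pq: "q \<in> D p" "p \<noteq> c" "q \<noteq> c" for p q
  proof (rule ccontr)
    assume "\<not> ?thesis"
    then have "2 \<le> card (D c - {p, q})" by simp
    then obtain T where "T \<subseteq> D c - {p, q}" "card T = 2" by (rule obtain_subset_with_card_n)
    then obtain a b where "a \<in> D c - {p, q}" "b \<in> D c - {p, q}" "a \<noteq> b"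
      by (auto simp: card_2_iff)
    moreover have "p \<noteq> q" using pq irrefl by blast
    moreover have "a \<noteq> c" "b \<noteq> c" using calculation irrefl by blast+
    ultimately show False using free[of a c b q p] pq by auto
  qed
  have "4 \<le> card (D c)"
  proof (rule ccontr)
    assume "\<not> 4 \<le> card (D c)"
    then consider "card (D c) = 2" | "card (D c) = 3" using two by linarith
    then have "(\<Sum>v\<in>N. card (D v)) \<le> 12"
    proof cases
      case 1
      \<comment> \<open>Every edge meets \<open>?T\<close>, as otherwise both neighbours of
        \<open>c\<close> would avoid it. Three vertices of degree at most 2 send out at most 6 arcs,
        and the reversed arcs double this to 12.\<close>
      let ?T = "insert c (D c)"
      have T: "finite ?T" "card ?T = 3" "?T \<subseteq> N" using finD irrefl 1 c(1) sub by auto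
      have fT: "finite (Sigma ?T D)" using T(1) finD by (intro finite_SigmaI) auto
      have "card (Sigma ?T D) = (\<Sum>v\<in>?T. card (D v))"
        using T(1) finD by (intro card_SigmaI) auto
      also have "\<dots> \<le> (\<Sum>v\<in>?T. 2)"
      proof (rule sum_mono)
        fix v assume "v \<in> ?T"
        then show "card (D v) \<le> 2" using max[of v] T(3) 1 by auto
      qed
      finally have six: "card (Sigma ?T D) \<le> 6" using T by simp
      have "Sigma N D \<subseteq> Sigma ?T D \<union> (Sigma ?T D)\<inverse>"
      proof
        fix e assume "e \<in> Sigma N D"
        then obtain p q where e: "e = (p, q)" "q \<in> D p" by auto
        have "p \<in> ?T \<or> q \<in> ?T"
        proof (rule ccontr)
          assume *: "\<not> ?thesis"
          then have "D c - {p, q} = D c" by auto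
          then show False using few[of q p] * e(2) 1 by simp
        qed
        then show "e \<in> Sigma ?T D \<union> (Sigma ?T D)\<inverse>" using e sym[of q p] by auto
      qed
      then have "card (Sigma N D) \<le> card (Sigma ?T D \<union> (Sigma ?T D)\<inverse>)"
        using fT by (intro card_mono) auto
      also have "\<dots> \<le> card (Sigma ?T D) + card ((Sigma ?T D)\<inverse>)" by (rule card_Un_le)
      also have "\<dots> \<le> 12" using six by (simp add: card_inverse)
      finally show ?thesis using fin finD by (simp add: card_SigmaI)
    next
      case 2
      \<comment> \<open>Every edge lies inside \<open>?T\<close>, as one with an end outside would
        avoid \<open>c\<close> and two of its three neighbours. Four vertices of degree at most 3
        have degree sum at most 12.\<close>
      let ?T = "insert c (D c)"
      have T: "finite ?T" "card ?T = 4" "?T \<subseteq> N" using finD irrefl 2 c(1) sub by auto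
      have "D v = {}" if "v \<in> N - ?T" for v
      proof (rule ccontr)
        assume "D v \<noteq> {}"
        then obtain q where q: "q \<in> D v" by blast
        then have "q \<noteq> c" using that sym[of c v] by auto
        moreover have "D c - {v, q} = D c - {q}" using that by auto
        ultimately have "card (D c - {q}) \<le> 1" using few[OF q] that by auto
        moreover have "card (D c) \<le> card (D c - {q}) + 1"
          by (simp add: card_Diff_singleton_if) linarith
        ultimately show False using 2 by simp
      qed
      then have "(\<Sum>v\<in>N. card (D v)) = (\<Sum>v\<in>?T. card (D v))"
        using fin T by (intro sum.mono_neutral_right) auto
      also have "\<dots> \<le> (\<Sum>v\<in>?T. 3)"
      proof (rule sum_mono)
        fix v assume "v \<in> ?T"
        then show "card (D v) \<le> 3" using max[of v] T(3) 2 by auto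
      qed
      also have "\<dots> = 12" using T by simp
      finally show ?thesis .
    qed
    then show False using many by simp
  qed
  moreover have "p = c \<or> q = c" if "q \<in> D p" for p q
  proof (rule ccontr)
    assume "\<not> ?thesis"
    then have "card (D c - {p, q}) \<le> 1" using few[OF that] by blast
    moreover have "card (D c) - card {p, q} \<le> card (D c - {p, q})"
      by (rule diff_card_le_card_Diff) simp
    moreover have "card {p, q} \<le> 2" by (simp add: card_insert_if)
    ultimately show False using \<open>4 \<le> card (D c)\<close> by linarith
  qed
  ultimately show ?thesis using that c(1) by blast
qed

section \<open>The identity for \<open>l^2 - l\<close> around a vertex of maximal entry\<close>

locale perron_vector =
  fixes G :: "'a pair_pre_digraph" and x :: "'a \<Rightarrow> real" and l :: real and u :: 'a
  assumes G: "pair_graph G"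
    and u: "u \<in> pverts G" and x_u: "x u = 1"
    and x_nonneg: "\<And>v. v \<in> pverts G \<Longrightarrow> 0 \<le> x v"
    and x_le_1: "\<And>v. v \<in> pverts G \<Longrightarrow> x v \<le> 1"
    and eig: "\<And>v. v \<in> pverts G \<Longrightarrow> (\<Sum>w\<in>nbrs G v. x w) = l * x v"
begin

definition N :: "'a set" where "N = nbrs G u"
definition W :: "'a set" where "W = pverts G - insert u N"
definition dN :: "'a \<Rightarrow> real" where "dN v = real (card (nbrs G v \<inter> N))"
definition dW :: "'a \<Rightarrow> real" where "dW v = real (card (nbrs G v \<inter> W))"

lemma N_subset: "N \<subseteq> pverts G"
  unfolding N_def by (rule nbrs_subset_verts[OF G])

lemma W_subset: "W \<subseteq> pverts G"
  unfolding W_def by blast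

lemma finite_N: "finite N" and finite_W: "finite W"
  using finite_subset[OF N_subset finite_pverts[OF G]] finite_subset[OF W_subset finite_pverts[OF G]] .

lemma u_notin_N: "u \<notin> N"
  unfolding N_def by (rule nbrs_irrefl[OF G])

lemma N_W_disjoint: "N \<inter> W = {}" and u_notin_W: "u \<notin> W"
  unfolding W_def by blast+

lemma verts_eq: "pverts G = insert u (N \<union> W)"
  unfolding W_def using u N_subset by blast

lemma nbrs_of_N: "v \<in> N \<Longrightarrow> nbrs G v = insert u ((nbrs G v \<inter> N) \<union> (nbrs G v \<inter> W))"
  using nbrs_subset_verts[OF G, of v] nbrs_sym[OF G, of u v] unfolding verts_eq N_def by blast

lemma nbrs_of_W: "w \<in> W \<Longrightarrow> nbrs G w = (nbrs G w \<inter> N) \<union> (nbrs G w \<inter> W)"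
  using nbrs_subset_verts[OF G, of w] nbrs_sym[OF G, of u w] unfolding verts_eq
  by (auto simp: W_def N_def)

lemma x_N: "v \<in> N \<Longrightarrow> 0 \<le> x v \<and> x v \<le> 1" and x_W: "v \<in> W \<Longrightarrow> 0 \<le> x v \<and> x v \<le> 1"
  using x_nonneg x_le_1 N_subset W_subset by blast+

lemma sum_N: "(\<Sum>v\<in>N. x v) = l"
  using eig[OF u] unfolding N_def x_u by simp

lemma sum_nbrs_of_N:
  fixes f :: "'a \<Rightarrow> real"
  assumes "v \<in> N"
  shows "(\<Sum>w\<in>nbrs G v. f w) = f u + (\<Sum>w\<in>nbrs G v \<inter> N. f w) + (\<Sum>w\<in>nbrs G v \<inter> W. f w)"
proof -
  have "(\<Sum>w\<in>nbrs G v. f w) = (\<Sum>w\<in>insert u ((nbrs G v \<inter> N) \<union> (nbrs G v \<inter> W)). f w)"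
    using nbrs_of_N[OF assms] by simp
  also have "\<dots> = f u + (\<Sum>w\<in>(nbrs G v \<inter> N) \<union> (nbrs G v \<inter> W). f w)"
    using finite_N finite_W u_notin_N u_notin_W by (intro sum.insert) auto
  also have "(\<Sum>w\<in>(nbrs G v \<inter> N) \<union> (nbrs G v \<inter> W). f w) =
      (\<Sum>w\<in>nbrs G v \<inter> N. f w) + (\<Sum>w\<in>nbrs G v \<inter> W. f w)"
    using finite_N finite_W N_W_disjoint by (intro sum.union_disjoint) auto
  finally show ?thesis by simp
qed

lemma sum_nbrs_of_W:
  fixes f :: "'a \<Rightarrow> real"
  assumes "v \<in> W"
  shows "(\<Sum>w\<in>nbrs G v. f w) = (\<Sum>w\<in>nbrs G v \<inter> N. f w) + (\<Sum>w\<in>nbrs G v \<inter> W. f w)"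
proof -
  have "(\<Sum>w\<in>nbrs G v. f w) = (\<Sum>w\<in>(nbrs G v \<inter> N) \<union> (nbrs G v \<inter> W). f w)"
    using nbrs_of_W[OF assms] by simp
  also have "\<dots> = (\<Sum>w\<in>nbrs G v \<inter> N. f w) + (\<Sum>w\<in>nbrs G v \<inter> W. f w)"
    using finite_N finite_W N_W_disjoint by (intro sum.union_disjoint) auto
  finally show ?thesis .
qed

text \<open>Applying the eigenvalue equation at \<open>u\<close> and then on \<open>N\<close> sums
  \<open>x\<close> over the ends of the walks of length two from \<open>u\<close>:
  \<open>card N\<close> of them return to \<open>u\<close>, and every other \<open>w\<close> is
  reached \<open>dN w\<close> times.\<close>

lemma l_squared: "l\<^sup>2 = real (card N) + (\<Sum>w\<in>N. dN w * x w) + (\<Sum>w\<in>W. dN w * x w)"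
proof -
  have "l\<^sup>2 = (\<Sum>v\<in>N. l * x v)"
    unfolding sum_distrib_left[symmetric] sum_N by (simp add: power2_eq_square)
  also have "\<dots> = (\<Sum>v\<in>N. 1 + (\<Sum>w\<in>nbrs G v \<inter> N. x w) + (\<Sum>w\<in>nbrs G v \<inter> W. x w))"
  proof (rule sum.cong[OF refl])
    fix v assume v: "v \<in> N"
    then show "l * x v = 1 + (\<Sum>w\<in>nbrs G v \<inter> N. x w) + (\<Sum>w\<in>nbrs G v \<inter> W. x w)"
      using eig[of v] sum_nbrs_of_N[OF v, of x] N_subset x_u by auto
  qed
  also have "\<dots> = real (card N) + (\<Sum>w\<in>N. dN w * x w) + (\<Sum>w\<in>W. dN w * x w)"
    unfolding sum.distrib dN_def
    using sum_sum_nbrs_swap[OF G finite_N finite_N, of x] sum_sum_nbrs_swap[OF G finite_N finite_W, of x]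
    by simp
  finally show ?thesis .
qed

text \<open>The degree sum is split over \<open>u\<close>, \<open>N\<close> and \<open>W\<close>;
  edges from \<open>u\<close> to \<open>N\<close> and from \<open>N\<close> to \<open>W\<close> are
  met from both sides, whence the factors 2.\<close>

lemma twice_edges:
  "2 * real (card (edge_set G)) =
    2 * real (card N) + (\<Sum>v\<in>N. dN v) + 2 * (\<Sum>w\<in>W. dN w) + (\<Sum>w\<in>W. dW w)"
proof -
  have "2 * real (card (edge_set G)) = (\<Sum>v\<in>insert u (N \<union> W). \<Sum>w\<in>nbrs G v. 1)"
    using card_parcs[OF G] unfolding verts_eq[symmetric] by (simp flip: of_nat_sum)
  also have "\<dots> = (\<Sum>w\<in>nbrs G u. 1) + ((\<Sum>v\<in>N. \<Sum>w\<in>nbrs G v. 1) + (\<Sum>v\<in>W. \<Sum>w\<in>nbrs G v. 1))"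
    using finite_N finite_W u_notin_N u_notin_W N_W_disjoint
    by (subst sum.insert) (auto simp: sum.union_disjoint)
  also have "(\<Sum>w\<in>nbrs G u. 1) = real (card N)" by (simp add: N_def)
  also have "(\<Sum>v\<in>N. \<Sum>w\<in>nbrs G v. 1) = (\<Sum>v\<in>N. 1 + dN v + dW v)"
    using sum_nbrs_of_N[of _ "\<lambda>_. 1"] by (intro sum.cong) (simp_all add: dN_def dW_def)
  also have "\<dots> = real (card N) + (\<Sum>v\<in>N. dN v) + (\<Sum>v\<in>N. dW v)"
    by (simp add: sum.distrib)
  also have "(\<Sum>v\<in>N. dW v) = (\<Sum>w\<in>W. dN w)"
    using sum_sum_nbrs_swap[OF G finite_N finite_W, of "\<lambda>_. 1"] by (simp add: dN_def dW_def)
  also have "(\<Sum>v\<in>W. \<Sum>w\<in>nbrs G v. 1) = (\<Sum>v\<in>W. dN v + dW v)"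
    using sum_nbrs_of_W[of _ "\<lambda>_. 1"] by (intro sum.cong) (simp_all add: dN_def dW_def)
  also have "\<dots> = (\<Sum>v\<in>W. dN v) + (\<Sum>v\<in>W. dW v)" by (rule sum.distrib)
  finally show ?thesis by simp
qed

text \<open>\<open>sum_N\<close> writes \<open>l\<close> as a sum over \<open>N\<close>, and half of
  \<open>twice_edges\<close> trades \<open>card N\<close> in \<open>l_squared\<close> for the number
  of edges.\<close>

lemma key_identity:
  "l\<^sup>2 - l = real (card (edge_set G)) + (\<Sum>v\<in>N. (dN v - 1) * x v - dN v / 2)
    - (\<Sum>w\<in>W. dN w * (1 - x w)) - (\<Sum>w\<in>W. dW w) / 2"
proof -
  have "(\<Sum>v\<in>N. (dN v - 1) * x v - dN v / 2) = (\<Sum>v\<in>N. dN v * x v) - l - (\<Sum>v\<in>N. dN v) / 2"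
    unfolding sum_N[symmetric] by (simp add: algebra_simps sum_subtractf sum_divide_distrib)
  moreover have "(\<Sum>w\<in>W. dN w * (1 - x w)) = (\<Sum>w\<in>W. dN w) - (\<Sum>w\<in>W. dN w * x w)"
    by (simp add: algebra_simps sum_subtractf)
  ultimately show ?thesis using l_squared twice_edges by simp
qed

end

section \<open>Forcing the structure of a star cone\<close>

text \<open>The last two assumptions are what the argument takes from a spectral radius of at least
  \<open>lambda_tilde m\<close>; for the largest root itself they are part of lemma
  \<open>lambda_tilde\<close>.\<close>

locale fish_free_perron_vector = perron_vector +
  assumes fish_free: "\<not> contains_graph G fish_graph"
    and no_isolated: "\<nexists>v. isolated_vertex G v"
    and l_gt_8: "l > 8" and l_large: "l\<^sup>2 - l > real (card (edge_set G)) - 2"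
begin

text \<open>The edges from \<open>u\<close> to \<open>N\<close> complete the 4-cycle
  \<open>u, a, w, b\<close> and the triangle \<open>u, p, q\<close>. The vertex \<open>w\<close> may
  lie in \<open>N\<close> or in \<open>W\<close>.\<close>

lemma no_fish:
  assumes "a \<in> N" "b \<in> N" "p \<in> N" "q \<in> N" "w \<noteq> u" "a \<in> nbrs G w" "b \<in> nbrs G w" "q \<in> nbrs G p"
    and "distinct [a, b, w, p, q]"
  shows False
proof -
  have "distinct [u, a, w, b, p, q]" using assms u_notin_N by auto
  moreover have "a \<in> nbrs G u" "w \<in> nbrs G a" "b \<in> nbrs G w" "u \<in> nbrs G b"
      "p \<in> nbrs G u" "q \<in> nbrs G p" "u \<in> nbrs G q"
    using assms nbrs_sym[OF G] unfolding N_def by blast+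
  ultimately show False using contains_fishI[OF G] fish_free by blast
qed

lemma dN_nonneg: "0 \<le> dN v" and dW_nonneg: "0 \<le> dW v"
  by (simp_all add: dN_def dW_def)

lemma sum_W_nonneg: "0 \<le> (\<Sum>w\<in>W. dN w * (1 - x w))" "0 \<le> (\<Sum>w\<in>W. dW w)"
  using dN_nonneg dW_nonneg x_W by (auto intro!: sum_nonneg mult_nonneg_nonneg)

lemma N_sum_bound: "-2 < (\<Sum>v\<in>N. (dN v - 1) * x v - dN v / 2)"
  using key_identity l_large sum_W_nonneg by linarith

lemma ex_star_centre:
  obtains c where "c \<in> N" "4 \<le> card (nbrs G c \<inter> N)"
    "\<And>p q. p \<in> N \<Longrightarrow> q \<in> nbrs G p \<inter> N \<Longrightarrow> p = c \<or> q = c"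
proof -
  \<comment> \<open>Emptied outside \<open>N\<close>, \<open>D\<close> is the adjacency of the
    subgraph induced on \<open>N\<close>.\<close>
  define D where "D v = (if v \<in> N then nbrs G v \<inter> N else {})" for v
  have dN: "dN v = real (card (D v))" if "v \<in> N" for v
    using that by (simp add: dN_def D_def)
  have many: "12 < (\<Sum>v\<in>N. card (D v))"
  proof -
    \<comment> \<open>Since \<open>x\<close> sums to \<open>l > 8\<close> over \<open>N\<close>, the
      bound -2 turns into 6, and \<open>x v \<le> 1\<close> then gives a degree sum above
      12.\<close>
    have "-2 < (\<Sum>v\<in>N. dN v * (x v - 1 / 2) - x v)"
      using N_sum_bound by (simp add: algebra_simps)
    also have "\<dots> = (\<Sum>v\<in>N. dN v * (x v - 1 / 2)) - l"
      by (simp add: sum_subtractf sum_N)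
    finally have "6 < (\<Sum>v\<in>N. dN v * (x v - 1 / 2))" using l_gt_8 by simp
    also have "\<dots> \<le> (\<Sum>v\<in>N. dN v * (1 / 2))"
      using x_N dN_nonneg by (intro sum_mono mult_left_mono) auto
    also have "\<dots> = (\<Sum>v\<in>N. dN v) / 2" by (simp add: sum_divide_distrib)
    also have "(\<Sum>v\<in>N. dN v) = real (\<Sum>v\<in>N. card (D v))" using dN by simp
    finally show ?thesis by linarith
  qed
  have path: "\<exists>c\<in>N. 2 \<le> card (D c)"
  proof (rule ccontr)
    assume *: "\<not> ?thesis"
    \<comment> \<open>In a matching each term is at most \<open>- (dN v / 2)\<close>, so the sum
      would fall below -6.\<close>
    have "(\<Sum>v\<in>N. (dN v - 1) * x v - dN v / 2) \<le> (\<Sum>v\<in>N. - (dN v / 2))"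
    proof (rule sum_mono)
      fix v assume v: "v \<in> N"
      then have "dN v \<le> 1" using * dN[OF v] by force
      then have "(dN v - 1) * x v \<le> 0" using x_N[OF v] by (intro mult_nonpos_nonneg) auto
      then show "(dN v - 1) * x v - dN v / 2 \<le> - (dN v / 2)" by simp
    qed
    also have "\<dots> = - (\<Sum>v\<in>N. dN v) / 2" by (simp add: sum_negf sum_divide_distrib)
    also have "(\<Sum>v\<in>N. dN v) = real (\<Sum>v\<in>N. card (D v))" using dN by simp
    finally show False using N_sum_bound many by linarith
  qed
  obtain c where c: "c \<in> N" "4 \<le> card (D c)" "\<And>p q. q \<in> D p \<Longrightarrow> p = c \<or> q = c"
  proof (rule P3_K2_free_imp_star[of N D])
    show "finite N" by (rule finite_N)
    show "D v \<subseteq> N" for v by (auto simp: D_def)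
    show "v \<in> D w" if "w \<in> D v" for v w
      using that nbrs_sym[OF G, of v w] by (auto simp: D_def split: if_splits)
    show "v \<notin> D v" for v using nbrs_irrefl[OF G, of v] by (auto simp: D_def)
    show False if "a \<in> D c" "b \<in> D c" "q \<in> D p" "distinct [a, b, c, p, q]" for a b c p q
    proof (rule no_fish[of a b p q c])
      show "c \<noteq> u" using that(1) u_notin_N by (auto simp: D_def split: if_splits)
    qed (use that in \<open>auto simp: D_def split: if_splits\<close>)
  qed (use many path in auto)
  show ?thesis
  proof (rule that[of c])
    show "4 \<le> card (nbrs G c \<inter> N)" using c(1,2) by (simp add: D_def)
    show "p = c \<or> q = c" if "p \<in> N" "q \<in> nbrs G p \<inter> N" for p q
      using c(3)[of q p] that by (simp add: D_def)
  qed (rule c(1))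
qed

text \<open>For a star on \<open>N\<close>, \<open>key_identity\<close> reads
  \<open>l^2 - l = m - 1 - T\<close> with nonnegative losses collected in \<open>T\<close>, and
  \<open>l_large\<close> leaves \<open>T < 1\<close>. A nonempty \<open>W\<close>, or a set
  \<open>P\<close> of size other than 0 and 2, contradicts this bound, the parity of
  \<open>m\<close>, or the two together.\<close>

lemma ex_star_cone:
  assumes odd: "odd (card (edge_set G))"
  obtains c L P where "star_cone G u c L P" "card (edge_set G) = 2 * card L + 1 + card P"
    "card P = 0 \<or> card P = 2"
proof -
  obtain c where c: "c \<in> N" "4 \<le> card (nbrs G c \<inter> N)"
    and star: "\<And>p q. p \<in> N \<Longrightarrow> q \<in> nbrs G p \<inter> N \<Longrightarrow> p = c \<or> q = c"
    using ex_star_centre by blast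
  define L where "L = nbrs G c \<inter> N"
  define P where "P = N - insert c L"
  define r where "r = real (card L)"
  define m where "m = card (edge_set G)"
  have fin: "finite L" "finite P" using finite_N by (auto simp: L_def P_def)
  have cL: "c \<notin> L" using nbrs_irrefl[OF G, of c] by (simp add: L_def)
  have N_eq: "N = insert c (L \<union> P)" using c(1) by (auto simp: L_def P_def)
  have disj: "L \<inter> P = {}" "c \<notin> P" by (auto simp: P_def)
  have r4: "r \<ge> 4" using c(2) by (simp add: r_def L_def)
  have nL: "nbrs G v \<inter> N = {c}" if "v \<in> L" for v
  proof -
    have "c \<in> nbrs G v \<inter> N" using that nbrs_sym[OF G, of v c] c(1) by (auto simp: L_def)
    moreover have "q = c" if "q \<in> nbrs G v \<inter> N" for q
      using star[OF _ that] \<open>v \<in> L\<close> cL by (auto simp: L_def)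
    ultimately show ?thesis by blast
  qed
  have nP: "nbrs G v \<inter> N = {}" if "v \<in> P" for v
  proof -
    have False if "q \<in> nbrs G v \<inter> N" for q
      using star[OF _ that] that \<open>v \<in> P\<close> nbrs_sym[OF G, of v q] by (auto simp: P_def L_def)
    then show ?thesis by blast
  qed
  have dN_c: "dN c = r" by (simp add: dN_def r_def L_def)
  have dN_L: "dN v = 1" if "v \<in> L" for v by (simp add: dN_def nL[OF that])
  have dN_P: "dN v = 0" if "v \<in> P" for v by (simp add: dN_def nP[OF that])
  have sum_N_split: "(\<Sum>v\<in>N. f v) = f c + (\<Sum>v\<in>L. f v) + (\<Sum>v\<in>P. f v)" for f :: "'a \<Rightarrow> real"
    unfolding N_eq using fin cL disj by (simp add: sum.union_disjoint)
  have xc: "0 \<le> x c" "x c \<le> 1" using x_N[OF c(1)] by auto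
  have x_P: "0 \<le> x v" "x v \<le> 1" if "v \<in> P" for v using x_N[of v] that by (auto simp: P_def)
  define A where "A = (\<Sum>v\<in>P. x v)"
  define B where "B = (\<Sum>w\<in>W. dN w * (1 - x w))"
  define E where "E = (\<Sum>w\<in>W. dW w)"
  \<comment> \<open>The losses come, in order, from an entry at the centre below 1, from
    \<open>P\<close>, from edges between \<open>N\<close> and \<open>W\<close>, and from edges
    inside \<open>W\<close>.\<close>
  define T where "T = (r - 1) * (1 - x c) + A + B + E / 2"
  have "(\<Sum>v\<in>N. (dN v - 1) * x v - dN v / 2) = (r - 1) * x c - r / 2 - r / 2 - A"
    unfolding sum_N_split by (simp add: dN_c dN_L dN_P r_def A_def sum_negf)
  then have T: "l\<^sup>2 - l = real m - 1 - T"
    using key_identity by (simp add: T_def B_def E_def m_def algebra_simps)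
  then have T1: "T < 1" using l_large by (simp add: m_def)
  have rc: "(r - 1) * (1 - x c) \<ge> 0" using r4 xc by simp
  have A0: "A \<ge> 0" unfolding A_def using x_P by (intro sum_nonneg) auto
  have B0: "B \<ge> 0" and E0: "E \<ge> 0" using sum_W_nonneg by (auto simp: B_def E_def)
  \<comment> \<open>An edge inside \<open>W\<close> counts in \<open>dW\<close> at both ends, so
    \<open>E / 2\<close> alone would reach 1.\<close>
  have nW: "nbrs G w \<inter> W = {}" if w: "w \<in> W" for w
  proof (rule ccontr)
    assume "\<not> ?thesis"
    then obtain w' where w': "w' \<in> nbrs G w" "w' \<in> W" by blast
    have "w \<in> nbrs G w'" using w'(1) nbrs_sym[OF G] by blast
    have one: "dW v \<ge> 1" if "v' \<in> nbrs G v" "v' \<in> W" for v v'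
    proof -
      have "card (nbrs G v \<inter> W) > 0" using that finite_W by (auto simp: card_gt_0_iff)
      then show ?thesis by (simp add: dW_def)
    qed
    have "w \<noteq> w'" using w'(1) nbrs_irrefl[OF G] by blast
    then have "dW w + dW w' = (\<Sum>v\<in>{w, w'}. dW v)" by simp
    also have "\<dots> \<le> E" unfolding E_def
      using w w'(2) finite_W dW_nonneg by (intro sum_mono2) auto
    finally have "E \<ge> 2" using one[OF w'] one[OF \<open>w \<in> nbrs G w'\<close> w] by linarith
    then show False using T1 rc A0 B0 by (simp add: T_def)
  qed
  have "E = 0" unfolding E_def by (simp add: dW_def nW)
  have W_nbrs: "nbrs G w = nbrs G w \<inter> N" "nbrs G w \<noteq> {}" if "w \<in> W" for w
    using nbrs_of_W[OF that] nW[OF that] no_isolated that W_subset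
    by (auto simp: isolated_vertex_def nbrs_def)
  \<comment> \<open>Two neighbours \<open>a\<close>, \<open>b\<close> of \<open>w\<close> other than
    \<open>c\<close> give the 4-cycle \<open>u, a, w, b\<close>; one of the at least four leaves
    avoids both and forms a triangle with \<open>u\<close> and \<open>c\<close>.\<close>
  have W_card: "card (nbrs G w - {c}) \<le> 1" if w: "w \<in> W" for w
  proof (rule ccontr)
    assume "\<not> ?thesis"
    then have "2 \<le> card (nbrs G w - {c})" by simp
    then obtain S where "S \<subseteq> nbrs G w - {c}" "card S = 2" by (rule obtain_subset_with_card_n)
    then obtain a b where ab: "a \<in> nbrs G w" "b \<in> nbrs G w" "a \<noteq> c" "b \<noteq> c" "a \<noteq> b"
      by (auto simp: card_2_iff)
    have "card L - card {a, b} \<le> card (L - {a, b})" by (rule diff_card_le_card_Diff) simp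
    moreover have "card {a, b} \<le> 2" by (simp add: card_insert_if)
    ultimately have "card (L - {a, b}) \<noteq> 0" using c(2) by (simp add: L_def)
    then obtain p where p: "p \<in> L" "p \<noteq> a" "p \<noteq> b" by (metis Diff_iff all_not_in_conv card.empty insertI1 insertI2)
    have abN: "a \<in> N" "b \<in> N" using ab W_nbrs(1)[OF w] by blast+
    have "p \<in> N" "p \<in> nbrs G c" using p(1) by (auto simp: L_def)
    moreover have "w \<notin> N" "w \<noteq> u" using w N_W_disjoint u_notin_W by blast+
    moreover have "p \<noteq> c" using p(1) cL by blast
    ultimately show False
      using no_fish[of a b c p w] abN ab p c(1) by auto
  qed
  have x_W_nbrs: "l * x w \<le> dN w" "1 \<le> dN w" "dN w \<le> 2" if w: "w \<in> W" for w
  proof -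
    have card: "dN w = real (card (nbrs G w))" using W_nbrs(1)[OF w] by (simp add: dN_def)
    have "l * x w = (\<Sum>v\<in>nbrs G w. x v)" using eig[of w] w W_subset by auto
    also have "\<dots> \<le> (\<Sum>v\<in>nbrs G w. 1)"
      using x_le_1 nbrs_subset_verts[OF G, of w] by (intro sum_mono) auto
    finally show "l * x w \<le> dN w" using card by simp
    show "1 \<le> dN w" using W_nbrs(2)[OF w] finite_nbrs[OF G, of w] unfolding card
      by (simp add: Suc_le_eq card_gt_0_iff)
    have "card (nbrs G w) \<le> card (nbrs G w - {c}) + 1"
      by (simp add: card_Diff_singleton_if) linarith
    then show "dN w \<le> 2" using W_card[OF w] unfolding card by simp
  qed
  have B_term: "dN w * (1 - x w) \<ge> 7 / 8" if w: "w \<in> W" for w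
  proof -
    have "x w \<le> dN w / l" using x_W_nbrs(1)[OF w] l_gt_8 by (simp add: field_simps)
    also have "\<dots> \<le> dN w / 8" using l_gt_8 x_W_nbrs(2)[OF w] by (intro divide_left_mono) auto
    finally have "dN w * (1 - dN w / 8) \<le> dN w * (1 - x w)"
      using x_W_nbrs(2)[OF w] by (intro mult_left_mono) auto
    \<comment> \<open>The product is 8 times the excess of \<open>dN w * (1 - dN w / 8)\<close> over
      \<open>7 / 8\<close>.\<close>
    moreover have "(dN w - 1) * (7 - dN w) \<ge> 0"
      using x_W_nbrs[OF w] by (intro mult_nonneg_nonneg) auto
    then have "7 / 8 \<le> dN w * (1 - dN w / 8)" by (simp add: algebra_simps)
    ultimately show ?thesis by linarith
  qed
  have edges: "real m = 2 * r + 1 + real (card P) + (\<Sum>w\<in>W. dN w)"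
  proof -
    have "real (card N) = 1 + r + real (card P)"
      using sum_N_split[of "\<lambda>_. 1"] by (simp add: r_def)
    moreover have "(\<Sum>v\<in>N. dN v) = 2 * r"
      unfolding sum_N_split by (simp add: dN_c dN_L dN_P r_def)
    ultimately show ?thesis using twice_edges \<open>E = 0\<close> by (simp add: E_def m_def)
  qed
  have W_empty: "W = {}"
  proof (rule ccontr)
    assume "W \<noteq> {}"
    then obtain w where w: "w \<in> W" by blast
    have B_ge: "dN w * (1 - x w) \<le> B"
      unfolding B_def using w finite_W x_W dN_nonneg
      by (intro member_le_sum) (auto intro!: mult_nonneg_nonneg)
    have "W = {w}"
    proof (rule ccontr)
      assume "W \<noteq> {w}"
      then obtain w' where w': "w' \<in> W" "w' \<noteq> w" using w by blast
      have "(\<Sum>v\<in>{w, w'}. dN v * (1 - x v)) \<le> B" unfolding B_def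
        using w w' finite_W dN_nonneg x_W by (intro sum_mono2) (auto intro!: mult_nonneg_nonneg)
      then have "7 / 4 \<le> B" using B_term[OF w] B_term[OF w'(1)] w'(2) by simp
      then show False using T1 rc A0 E0 by (simp add: T_def)
    qed
    \<comment> \<open>Two neighbours would give \<open>x w \<le> 2 / 8\<close>, so that
      \<open>w\<close> alone would cost at least 1.\<close>
    have dN1: "dN w = 1"
    proof (rule ccontr)
      assume "dN w \<noteq> 1"
      moreover have "card (nbrs G w \<inter> N) = 1 \<or> card (nbrs G w \<inter> N) = 2"
        using x_W_nbrs(2,3)[OF w] by (auto simp: dN_def)
      ultimately have "dN w = 2" by (auto simp: dN_def)
      moreover have "8 * x w \<le> l * x w" using l_gt_8 x_W[OF w] by (intro mult_right_mono) auto
      ultimately have "1 \<le> dN w * (1 - x w)" using x_W_nbrs(1)[OF w] by simp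
      then show False using T1 rc A0 E0 B_ge by (simp add: T_def)
    qed
    \<comment> \<open>With \<open>w\<close> attached by a single edge, oddness of \<open>m\<close>
      forces a vertex \<open>p\<close> in \<open>P\<close>. Its neighbour \<open>u\<close> has entry
      1, so \<open>x w \<le> 1 / l \<le> x p\<close>, and the losses \<open>x p\<close> and
      \<open>1 - x w\<close> together reach 1.\<close>
    have "real m = real (2 * card L + 2 + card P)"
      using edges \<open>W = {w}\<close> dN1 by (simp add: r_def)
    then have "m = 2 * card L + 2 + card P" by (rule of_nat_eq_iff[THEN iffD1])
    then have "odd (card P)" using odd by (simp add: m_def)
    then have "card P \<noteq> 0" by (intro notI) simp
    then obtain p where p: "p \<in> P" by (metis card.empty ex_in_conv)
    have pN: "p \<in> N" using p by (simp add: P_def)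
    have "x u \<le> (\<Sum>v\<in>nbrs G p. x v)"
      using nbrs_of_N[OF pN] finite_nbrs[OF G] x_nonneg nbrs_subset_verts[OF G, of p]
      by (intro member_le_sum) auto
    then have "1 \<le> l * x p" using eig[of p] x_u pN N_subset by auto
    then have "l * x w \<le> l * x p" using x_W_nbrs(1)[OF w] dN1 by simp
    then have "x w \<le> x p" using l_gt_8 by simp
    also have "\<dots> \<le> A"
      unfolding A_def using p fin x_P by (intro member_le_sum) auto
    finally show False using T1 rc E0 B_ge dN1 by (simp add: T_def)
  qed
  then have "B = 0" by (simp add: B_def)
  have verts: "pverts G = {u, c} \<union> L \<union> P" using verts_eq W_empty N_eq by auto
  have nu: "nbrs G u = {c} \<union> L \<union> P" using N_eq by (simp add: N_def)
  have nbrs_N: "nbrs G v = insert u (nbrs G v \<inter> N)" if "v \<in> N" for v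
    using nbrs_of_N[OF that] W_empty by simp
  have nc: "nbrs G c = {u} \<union> L" using nbrs_N[OF c(1)] by (simp add: L_def)
  have nl: "nbrs G v = {u, c}" if "v \<in> L" for v
    using nbrs_N[of v] nL[OF that] that by (simp add: L_def)
  have np: "nbrs G v = {u}" if "v \<in> P" for v
    using nbrs_N[of v] nP[OF that] that by (simp add: P_def)
  have ucLP: "u \<noteq> c" "u \<notin> L" "u \<notin> P" using u_notin_N unfolding N_eq by auto
  have parcs: "parcs G \<subseteq> pverts G \<times> pverts G"
  proof
    fix e assume "e \<in> parcs G"
    then have "snd e \<in> nbrs G (fst e)" "fst e \<in> nbrs G (snd e)"
      using nbrs_sym[OF G, of "snd e" "fst e"] by (auto simp: nbrs_def)
    then show "e \<in> pverts G \<times> pverts G" using nbrs_subset_verts[OF G] by (cases e) auto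
  qed
  have cone: "star_cone G u c L P"
    unfolding star_cone_def using fin ucLP cL disj verts nu nc nl np parcs by simp
  have "real m = real (2 * card L + 1 + card P)" using edges W_empty by (simp add: r_def)
  then have m: "m = 2 * card L + 1 + card P" by (rule of_nat_eq_iff[THEN iffD1])
  then have even: "even (card P)" using odd by (simp add: m_def)
  \<comment> \<open>The eigenvalue equations give the loss exactly:
    \<open>T * (l * (l + 1)) = s * (r + l)\<close>. As \<open>T \<ge> 0\<close> bounds
    \<open>r\<close> from below, \<open>T < 1\<close> leads to \<open>s * l < 2 * (l + 1)\<close>,
    which is impossible for \<open>s \<ge> 4\<close>.\<close>
  have "card P < 4"
  proof (rule ccontr)
    assume "\<not> ?thesis"
    define s where "s = real (card P)"
    have s4: "s \<ge> 4" using \<open>\<not> card P < 4\<close> by (simp add: s_def)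
    have "l * x v = 1" if "v \<in> P" for v
      using eig[of v] np[OF that] that verts x_u by simp
    then have xP: "x v = 1 / l" if "v \<in> P" for v
      using that l_gt_8 by (simp add: field_simps)
    have A: "A = s / l" unfolding A_def by (simp add: xP s_def)
    have "l * x c = 1 + (\<Sum>v\<in>L. x v)"
      using eig[of c] nc verts fin ucLP x_u by simp
    moreover have "l = x c + (\<Sum>v\<in>L. x v) + A"
      using sum_N unfolding sum_N_split A_def by simp
    \<comment> \<open>In the difference of the equations at \<open>u\<close> and \<open>c\<close>
      the sum over \<open>L\<close> cancels.\<close>
    ultimately have "(l + 1) * (1 - x c) = s / l" unfolding A by (simp add: algebra_simps)
    then have q: "l * ((l + 1) * (1 - x c)) = s" using l_gt_8 by simp
    have A': "l * A = s" unfolding A using l_gt_8 by simp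
    have "T * (l * (l + 1)) = (r - 1) * (l * ((l + 1) * (1 - x c))) + (l + 1) * (l * A)"
      unfolding T_def \<open>B = 0\<close> \<open>E = 0\<close> by (simp add: algebra_simps)
    also have "\<dots> = s * (r + l)" unfolding q A' by (simp add: algebra_simps)
    finally have "T * (l * (l + 1)) = s * (r + l)" .
    moreover have "T * (l * (l + 1)) < 1 * (l * (l + 1))"
      using T1 l_gt_8 by (intro mult_strict_right_mono) auto
    ultimately have 1: "s * (r + l) < l * (l + 1)" by simp
    have "s / l < 1" using T1 rc by (simp add: T_def A \<open>B = 0\<close> \<open>E = 0\<close>)
    then have sl: "s < l" using l_gt_8 by simp
    have "T \<ge> 0" using rc A0 by (simp add: T_def \<open>B = 0\<close> \<open>E = 0\<close>)
    then have "2 * r \<ge> l\<^sup>2 - l - s" using T edges W_empty by (simp add: s_def)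
    then have "s * (l\<^sup>2 + l - s) \<le> s * (2 * (r + l))" using s4 by (intro mult_left_mono) auto
    also have "\<dots> = 2 * (s * (r + l))" by simp
    finally have "s * (l\<^sup>2 + l - s) \<le> 2 * (s * (r + l))" .
    moreover have "s * l\<^sup>2 \<le> s * (l\<^sup>2 + l - s)" using s4 sl by (intro mult_left_mono) auto
    ultimately have "s * l\<^sup>2 < 2 * (l * (l + 1))" using 1 by linarith
    then have "l * (s * l) < l * (2 * (l + 1))" by (simp add: power2_eq_square mult_ac)
    then have "s * l < 2 * (l + 1)" using l_gt_8 by (simp only: mult_less_cancel_left_pos)
    moreover have "4 * l \<le> s * l" using s4 l_gt_8 by (intro mult_right_mono) auto
    ultimately show False using l_gt_8 by simp
  qed
  then have "card P = 0 \<or> card P = 2" using even by (auto elim!: evenE)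
  with cone m show ?thesis using that unfolding m_def by blast
qed

end

section \<open>The bound and the case of equality\<close>

theorem theorem1p1:
  fixes G :: "'a pair_pre_digraph" and m :: nat
  assumes "58 \<le> m" and "odd m"
    and "pair_graph G"
    and "card (edge_set G) = m"
    and "\<nexists>v. isolated_vertex G v"
    and "\<not> contains_graph G fish_graph"
    and "\<not> G \<cong>\<^sub>g graph_join (complete_graph 2) (copies ((m - 1) div 2) (complete_graph 1))"
  shows "graph_spectral_radius G \<le> lambda_tilde m \<and>
    (graph_spectral_radius G = lambda_tilde m \<longleftrightarrow>
      G \<cong>\<^sub>g graph_join (complete_graph 1)
        (disjoint_union (star_graph ((m - 3) div 2)) (copies 2 (complete_graph 1))))"
proof -
  let ?ext = "graph_join (complete_graph 1)
    (disjoint_union (star_graph ((m - 3) div 2)) (copies 2 (complete_graph 1)))"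
  have "edge_set G \<noteq> {}" using assms(1,4) by auto
  then have "parcs G \<noteq> {}" by (auto simp: edge_set_def)
  then obtain v w where "w \<in> nbrs G v" by (auto simp: nbrs_def)
  then have ne: "pverts G \<noteq> {}" using nbrs_subset_verts[OF assms(3), of v] by blast
  note lt = lambda_tilde[OF assms(1)]
  have extremal: "G \<cong>\<^sub>g ?ext" if ge: "lambda_tilde m \<le> graph_spectral_radius G"
  proof -
    define l where "l = graph_spectral_radius G"
    have l: "l > 8" using ge lt(2) by (simp add: l_def)
    \<comment> \<open>\<open>t^2 - t\<close> is increasing in this range, so the lower bound passes
      from the largest root to \<open>l\<close>.\<close>
    have "0 \<le> (l - lambda_tilde m) * (l + lambda_tilde m - 1)"
      using ge lt(2) by (intro mult_nonneg_nonneg) (auto simp: l_def)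
    then have l2: "l\<^sup>2 - l > real m - 2"
      using lt(3) by (simp add: power2_eq_square algebra_simps)
    obtain y where y: "\<And>v. v \<in> pverts G \<Longrightarrow> y v \<ge> 0" "\<exists>v\<in>pverts G. y v > 0"
      and eig: "\<And>v. v \<in> pverts G \<Longrightarrow> (\<Sum>w\<in>nbrs G v. y w) = l * y v"
      using ex_nonneg_eigenvector[OF assms(3) ne] unfolding l_def by blast
    have fin: "finite (y ` pverts G)" using finite_pverts[OF assms(3)] by simp
    have "Max (y ` pverts G) \<in> y ` pverts G" using fin ne by (intro Max_in) auto
    then obtain u where u: "u \<in> pverts G" "y u = Max (y ` pverts G)" by auto
    have max: "y v \<le> y u" if "v \<in> pverts G" for v
      unfolding u(2) using fin that by simp
    have yu: "y u > 0" using y(2) max less_le_trans by blast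
    \<comment> \<open>Dividing by the maximal entry \<open>y u\<close> gives the normalization with
      value 1 at \<open>u\<close>.\<close>
    interpret fish_free_perron_vector G "\<lambda>v. y v / y u" l u
    proof (intro fish_free_perron_vector.intro perron_vector.intro fish_free_perron_vector_axioms.intro)
      show "(\<Sum>w\<in>nbrs G v. y w / y u) = l * (y v / y u)" if "v \<in> pverts G" for v
        using eig[OF that] by (simp add: sum_divide_distrib[symmetric])
    qed (use assms u(1) yu y(1) max l l2 in auto)
    obtain c L P where cone: "star_cone G u c L P" and m: "m = 2 * card L + 1 + card P"
      and P: "card P = 0 \<or> card P = 2"
      using ex_star_cone assms(2,4) by blast
    \<comment> \<open>An empty \<open>P\<close> would make \<open>G\<close> the excluded
      book.\<close>
    have "card P \<noteq> 0"
    proof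
      assume P0: "card P = 0"
      then have "(m - 1) div 2 = card L" using m by simp
      moreover have "card (Inr ` ({..<k} \<times> {0}) :: (nat + nat \<times> nat) set) = k" for k :: nat
        by (simp add: card_image card_cartesian_product)
      ultimately have "G \<cong>\<^sub>g graph_join (complete_graph 2) (copies ((m - 1) div 2) (complete_graph 1))"
        using P0 by (intro star_cone_iso[OF assms(3) cone star_cone_book]) simp_all
      then show False using assms(7) by blast
    qed
    then have P2: "card P = 2" using P by simp
    then have r: "(m - 3) div 2 = card L" using m by simp
    show ?thesis
    proof (rule star_cone_iso[OF assms(3) cone star_cone_join_star])
      show "card L = card (Inr ` Inl ` {1..(m - 3) div 2} :: (nat + nat + nat \<times> nat) set)"
        unfolding r by (simp add: card_image)
      show "card P = card (Inr ` Inr ` ({..<2} \<times> {0}) :: (nat + nat + nat \<times> nat) set)"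
        unfolding P2 by (simp add: card_image card_cartesian_product)
    qed
  qed
  have "graph_spectral_radius G = lambda_tilde m" if "G \<cong>\<^sub>g ?ext"
    using graph_spectral_radius_extremal[OF assms(1,2,3) ne that] .
  \<comment> \<open>A radius above the bound would make \<open>G\<close> the extremal graph, whose
    radius equals the bound; so \<open>extremal\<close> yields the inequality along with one
    direction of the equality case.\<close>
  with extremal show ?thesis by (metis linear order_refl)
qed

end
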